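(* Let $h>0$, let $w$ and $v$ be a weight function and a velocity function as in the context, $f(\rho)=\rho v(\rho)$ with stagnation point $\hat\rho$, and let $\rho^-,\rho^+$ satisfy $0<\rho^-<\hat\rho<\rho^+<1$ and $f(\rho^-)=f(\rho^+)$. For each $\ell>0$ let $\mathcal{P}^\ell:\mathbb{R}\to(0,1)$ be the discrete stationary profile of the velocity-averaging follow-the-leaders model with car length $\ell$ (see context) with $\lim_{x\to\pm\infty}\mathcal{P}^\ell(x)=\rho^\pm$ and $\mathcal{P}^\ell(0)=\hat\rho$. Then, as $\ell\to0$, $\mathcal{P}^\ell$ converges pointwise on $\mathbb{R}$ to $\mathcal{Q}$, where $\mathcal{Q}$ is the stationary profile (see context) of the nonlocal conservation law $$\rho_t+\left[\rho(t,x)\int_x^{x+h}v(\rho(t,y))w(y-x)\,dy\right]_x=0$$ with $\lim_{x\to\pm\infty}\mathcal{Q}(x)=\rho^\pm$ and $\mathcal{Q}(0)=\hat\rho$.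
   Context: Weight function: $w:\mathbb{R}\to[0,\infty)$ is continuous on $[0,h]$, $\int_0^h w(x)\,dx=1$, and $w(x)=0$ for $x\notin[0,h]$ ($w$ may jump at $0$ and $h$). Velocity function: $v\in C^2$ with $v(0)=1$, $v(1)=0$, $v'(\rho)<0$ for all $\rho\in[0,1]$. Stagnation point: it is assumed throughout that $f(\rho)=\rho v(\rho)$ has a unique $\hat\rho\in(0,1)$ with $f'(\hat\rho)=0$, $f'(\rho)>0$ for $\rho<\hat\rho$ and $f'(\rho)<0$ for $\rho>\hat\rho$. Discrete stationary profile for car length $\ell$: a continuous monotone increasing $\mathcal{P}:\mathbb{R}\to(0,1)$ satisfying $$\mathcal{P}'(x)=-\frac{\mathcal{P}^2(x)}{\ell\,B^{\mathcal{P}}(x)}\Big[B^{\mathcal{P}}\big(L^{\mathcal{P}}(x)\big)-B^{\mathcal{P}}(x)\Big]\quad\forall x\in\mathbb{R},$$ where $L^{\mathcal{P}}(x)=x+\ell/\mathcal{P}(x)$, $(L^{\mathcal{P}})^k$ is the $k$-fold composition, and $$B^{\mathcal{P}}(x)=\sum_{k=0}^{\infty}\left(\int_{(L^{\mathcal{P}})^k(x)}^{(L^{\mathcal{P}})^{k+1}(x)}w(y-x)\,dy\right)v\Big(\mathcal{P}\big((L^{\mathcal{P}})^k(x)\big)\Big).$$ Stationary profile of the conservation law: a continuous monotone increasing $\mathcal{Q}:\mathbb{R}\to(0,1)$ such that $\mathcal{Q}(x)\int_0^hv(\mathcal{Q}(x+s))w(s)\,ds$ is constant in $x\in\mathbb{R}$.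 Given the limits $\rho^\pm$ above, both kinds of profile exist and are unique up to horizontal shifts. *)

theory Defs
  imports "HOL-Analysis.Analysis"
begin

definition weight_function :: "real \<Rightarrow> (real \<Rightarrow> real) \<Rightarrow> bool" where
  "weight_function h w \<longleftrightarrow>
     (\<forall>x. 0 \<le> w x) \<and> continuous_on {0..h} w \<and> integral {0..h} w = 1 \<and>
     (\<forall>x. x \<notin> {0..h} \<longrightarrow> w x = 0)"

text \<open>Densities live in the unit interval, so velocities are only constrained there;
  derivatives are one-sided at the endpoints.\<close>

definition unit_deriv :: "(real \<Rightarrow> real) \<Rightarrow> real \<Rightarrow> real" where
  "unit_deriv g r = vector_derivative g (at r within {0..1})"

definition C2_unit :: "(real \<Rightarrow> real) \<Rightarrow> bool" where
  "C2_unit g \<longleftrightarrow>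
     g differentiable_on {0..1} \<and> unit_deriv g differentiable_on {0..1} \<and>
     continuous_on {0..1} (unit_deriv (unit_deriv g))"

definition velocity_function :: "(real \<Rightarrow> real) \<Rightarrow> bool" where
  "velocity_function v \<longleftrightarrow>
     C2_unit v \<and> v 0 = 1 \<and> v 1 = 0 \<and> (\<forall>r\<in>{0..1}. unit_deriv v r < 0)"

definition flux :: "(real \<Rightarrow> real) \<Rightarrow> real \<Rightarrow> real" where
  "flux v r = r * v r"

text \<open>The sign conditions make the point unique.\<close>

definition stagnation_point :: "(real \<Rightarrow> real) \<Rightarrow> real \<Rightarrow> bool" where
  "stagnation_point v r \<longleftrightarrow>
     0 < r \<and> r < 1 \<and> unit_deriv (flux v) r = 0 \<and>
     (\<forall>s\<in>{0..<r}. unit_deriv (flux v) s > 0) \<and>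
     (\<forall>s\<in>{r<..1}. unit_deriv (flux v) s < 0)"

definition leader :: "real \<Rightarrow> (real \<Rightarrow> real) \<Rightarrow> real \<Rightarrow> real" where
  "leader l P x = x + l / P x"

text \<open>For l > 0 and P with values in (0,1), only finitely many terms are nonzero, because
  the k-th iterate of the leader map is at least x + k l and w vanishes beyond h.\<close>

definition avg_velocity ::
    "(real \<Rightarrow> real) \<Rightarrow> (real \<Rightarrow> real) \<Rightarrow> real \<Rightarrow> (real \<Rightarrow> real) \<Rightarrow> real \<Rightarrow> real" where
  "avg_velocity w v l P x =
     (\<Sum>k. integral {(leader l P ^^ k) x .. (leader l P ^^ Suc k) x} (\<lambda>y. w (y - x))
          * v (P ((leader l P ^^ k) x)))"

definition discrete_stationary_profile ::
    "(real \<Rightarrow> real) \<Rightarrow> (real \<Rightarrow> real) \<Rightarrow> real \<Rightarrow> (real \<Rightarrow> real) \<Rightarrow> bool" where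
  "discrete_stationary_profile w v l P \<longleftrightarrow>
     continuous_on UNIV P \<and> mono P \<and> (\<forall>x. 0 < P x \<and> P x < 1) \<and>
     (\<forall>x. (P has_real_derivative
        - ((P x)\<^sup>2 / (l * avg_velocity w v l P x))
          * (avg_velocity w v l P (leader l P x) - avg_velocity w v l P x)) (at x))"

definition stationary_profile ::
    "real \<Rightarrow> (real \<Rightarrow> real) \<Rightarrow> (real \<Rightarrow> real) \<Rightarrow> (real \<Rightarrow> real) \<Rightarrow> bool" where
  "stationary_profile h w v Q \<longleftrightarrow>
     continuous_on UNIV Q \<and> mono Q \<and> (\<forall>x. 0 < Q x \<and> Q x < 1) \<and>
     (\<exists>c. \<forall>x. Q x * integral {0..h} (\<lambda>s. v (Q (x + s)) * w s) = c)"

end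

theory Submission
  imports Defs "HOL-Probability.Helly_Selection"
begin

text \<open>
  Proof idea. The discrete profile equation is equivalent to \<open>L' = B \<circ> L / B\<close> for the leader map \<open>L\<close>, so
  \<open>\<integral>\<^bsub>x\<^esub>\<^bsup>L x\<^esup> 1 / B\<close> is constant. By the mean value theorem and the behaviour at \<open>\<infinity>\<close>,
  \<open>P x * B \<xi> = \<rho>plus * v \<rho>plus\<close> for some \<open>\<xi>\<close> within \<open>O(l)\<close> of \<open>x\<close>, and monotonicity squeezes \<open>B\<close> between shifts by
  \<open>O(l)\<close> of the nonlocal average of \<open>v \<circ> P\<close>. Such functions are equicontinuous up to \<open>O(l)\<close>, so by
  Helly's theorem every sequence \<open>l \<rightarrow> 0\<close> has a subsequence along which the profiles converge to a
  stationary profile of the conservation law.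

  Uniqueness of stationary profiles \<open>R1\<close>, \<open>R2\<close>: the equation determines \<open>Q x\<close> from the values of \<open>Q\<close> on \<open>[x, x + h]\<close> in an
  order-preserving way, so an ordering on a window of length \<open>h\<close> propagates to the left. Let \<open>[m, M]\<close> be the
  smallest interval of shifts with \<open>R2 (y + m) \<le> R1 y \<le> R2 (y + M)\<close> for all \<open>y\<close>. If \<open>m < M\<close>, then every window far
  to the right contains a point where the first inequality is almost attained and one where the
  second is; a strong maximum principle spreads both to the right until they collide,
  which would make \<open>R2\<close> too flat there: \<open>rp - R2\<close> decays by a fixed factor over each length \<open>h\<close>, because
  the flux has negative slope at \<open>rp = \<rho>plus\<close>.
\<close>

section \<open>The nonlocal average\<close>

text \<open>Smoothness of \<open>v\<close> enters only through the two-sided difference bounds with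
  \<beta> and \<open>Lv\<close>. The number \<open>rp\<close> stands for \<rho>plus.\<close>

locale nonlocal_traffic =
  fixes h :: real and w v :: "real \<Rightarrow> real" and rp Lv \<beta> :: real
  assumes h_pos: "0 < h"
    and w_nonneg: "\<And>x. 0 \<le> w x"
    and w_cont: "continuous_on {0..h} w"
    and w_int: "integral {0..h} w = 1"
    and w_zero: "\<And>x. x \<notin> {0..h} \<Longrightarrow> w x = 0"
    and v_0: "v 0 = 1" and v_1: "v 1 = 0"
    and \<beta>_pos: "0 < \<beta>"
    and v_dec: "\<And>a b. 0 \<le> a \<Longrightarrow> a \<le> b \<Longrightarrow> b \<le> 1 \<Longrightarrow> \<beta> * (b - a) \<le> v a - v b"
    and v_lip: "\<And>a b. 0 \<le> a \<Longrightarrow> a \<le> b \<Longrightarrow> b \<le> 1 \<Longrightarrow> v a - v b \<le> Lv * (b - a)"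
    and rp_pos: "0 < rp" and rp_less: "rp < 1"
begin

definition wavg :: "(real \<Rightarrow> real) \<Rightarrow> real \<Rightarrow> real" where
  "wavg g x = integral {0..h} (\<lambda>s. g (x + s) * w s)"

lemma Lv_pos: "0 < Lv"
  using v_dec[of 0 1] v_lip[of 0 1] \<beta>_pos by simp

lemma v_antimono: "v b \<le> v a" if "0 \<le> a" "a \<le> b" "b \<le> 1"
  using v_dec[OF that] \<beta>_pos that by (smt (verit) mult_nonneg_nonneg)

lemma v_bounds: "0 \<le> v a" "v a \<le> 1" if "0 \<le> a" "a \<le> 1"
  using v_antimono[of 0 a] v_antimono[of a 1] that v_0 v_1 by auto

lemma v_rp_pos: "0 < v rp"
  using v_dec[of rp 1] rp_pos rp_less \<beta>_pos v_1 by (smt (verit) mult_pos_pos)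

lemma v_cont: "continuous_on {0..1} v"
proof -
  have "\<bar>v a - v b\<bar> \<le> Lv * \<bar>a - b\<bar>" if "a \<in> {0..1}" "b \<in> {0..1}" for a b
    using v_lip[of a b] v_lip[of b a] v_antimono[of a b] v_antimono[of b a] that by (cases "a \<le> b") auto
  then have "Lv-lipschitz_on {0..1} v"
    using Lv_pos by (intro lipschitz_onI) (auto simp: dist_real_def)
  then show ?thesis by (rule lipschitz_on_continuous_on)
qed

lemma wavg_integrable:
  assumes "continuous_on UNIV g"
  shows "(\<lambda>s. g (x + s) * w s) integrable_on {0..h}"
proof (rule integrable_continuous_real)
  show "continuous_on {0..h} (\<lambda>s. g (x + s) * w s)"
    by (intro continuous_intros w_cont continuous_on_compose2[OF assms]) auto
qed

lemma wavg_mono: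
  assumes "continuous_on UNIV f" "continuous_on UNIV g"
    and "\<And>y. x \<le> y \<Longrightarrow> y \<le> x + h \<Longrightarrow> f y \<le> g y"
  shows "wavg f x \<le> wavg g x"
  unfolding wavg_def
  using assms by (intro integral_le wavg_integrable mult_right_mono w_nonneg) auto

lemma wavg_const [simp]: "wavg (\<lambda>_. c) x = c"
  by (simp add: wavg_def w_int)

lemma wavg_diff:
  assumes "continuous_on UNIV f" "continuous_on UNIV g"
  shows "wavg (\<lambda>y. f y - g y) x = wavg f x - wavg g x"
  unfolding wavg_def
  by (simp add: left_diff_distrib integral_diff wavg_integrable assms)

lemma wavg_cmult: "wavg (\<lambda>y. c * f y) x = c * wavg f x"
  by (simp add: wavg_def mult.assoc)

lemma wavg_shift: "wavg (\<lambda>y. g (y + a)) x = wavg g (x + a)"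
  by (simp add: wavg_def add_ac)

lemma wavg_bounds:
  assumes "continuous_on UNIV g" "antimono g"
  shows "g (x + h) \<le> wavg g x" "wavg g x \<le> g x"
  using wavg_mono[of "\<lambda>_. g (x + h)" g x] wavg_mono[of g "\<lambda>_. g x" x] assms
  by (auto simp: antimono_def)

lemma wavg_antimono:
  assumes "continuous_on UNIV g" "antimono g" "x \<le> y"
  shows "wavg g y \<le> wavg g x"
  unfolding wavg_def
  using assms by (intro integral_le wavg_integrable mult_right_mono w_nonneg) (auto simp: antimono_def)

section \<open>Mass and positivity of the weight, regularity of the average\<close>

lemma w_integrable: "0 \<le> a \<Longrightarrow> b \<le> h \<Longrightarrow> w integrable_on {a..b}"
  by (intro integrable_continuous_real continuous_on_subset[OF w_cont]) auto

lemma w_bounded: obtains W where "0 < W" "\<And>s. s \<in> {0..h} \<Longrightarrow> w s \<le> W"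
proof -
  have "compact (w ` {0..h})" by (intro compact_continuous_image w_cont) auto
  then obtain B where "\<forall>y\<in>w ` {0..h}. \<bar>y\<bar> \<le> B"
    using compact_imp_bounded bounded_real by metis
  then show ?thesis by (intro that[of "max B 1"]) force+
qed

text \<open>A bound \<open>W\<close> of the weight gives mass at most \<open>W * \<epsilon>\<close>.
  This makes the comparison of two profiles contractive on short intervals.\<close>

lemma w_small_mass:
  assumes "0 < \<eta>"
  obtains \<delta> where "0 < \<delta>" "\<delta> \<le> h" "\<And>\<epsilon>. 0 \<le> \<epsilon> \<Longrightarrow> \<epsilon> \<le> \<delta> \<Longrightarrow> integral {0..\<epsilon>} w \<le> \<eta>"
proof -
  obtain W where W: "0 < W" "\<And>s. s \<in> {0..h} \<Longrightarrow> w s \<le> W" using w_bounded by blast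
  show ?thesis
  proof (rule that[of "min h (\<eta> / W)"])
    fix \<epsilon> assume e: "0 \<le> \<epsilon>" "\<epsilon> \<le> min h (\<eta> / W)"
    have "integral {0..\<epsilon>} w \<le> integral {0..\<epsilon>} (\<lambda>_. W)"
      using e W by (intro integral_le w_integrable) auto
    also have "\<dots> = W * \<epsilon>" using e by simp
    also have "\<dots> \<le> \<eta>" using e W by (simp add: field_simps)
    finally show "integral {0..\<epsilon>} w \<le> \<eta>" .
  qed (use W assms h_pos in auto)
qed

text \<open>Unit mass makes \<open>w\<close> positive somewhere, and continuity spreads this to an
  interval. With \<open>0 < s1\<close> each propagation step moves to the right, and with
  \<open>s1 < s2\<close> the reachable range widens with the number of steps.\<close>

lemma w_positive_interval:
  obtains s1 s2 w0 where "0 < s1" "s1 < s2" "s2 \<le> h" "0 < w0" "\<And>s. s \<in> {s1..s2} \<Longrightarrow> w0 \<le> w s"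
proof -
  have "\<exists>s\<in>{0..h}. w s \<noteq> 0"
  proof (rule ccontr)
    assume "\<not> ?thesis"
    then have "integral {0..h} w = integral {0..h} (\<lambda>_. 0)" by (intro integral_cong) auto
    then show False using w_int by simp
  qed
  then obtain s where s: "s \<in> {0..h}" "0 < w s" using w_nonneg by (metis order_le_less)
  obtain d where d: "0 < d" "\<And>t. t \<in> {0..h} \<Longrightarrow> dist t s < d \<Longrightarrow> dist (w t) (w s) < w s / 2"
    using w_cont s unfolding continuous_on_iff by (metis half_gt_zero)
  define e where "e = min d h / 4"
  have e: "0 < e" "4 * e \<le> h" "4 * e \<le> d" using d h_pos by (auto simp: e_def)
  \<comment> \<open>The point \<open>s\<close> may be an endpoint of \<open>[0, h]\<close>; an
    interval of length \<open>e\<close> shifted towards the middle stays to the right of 0 and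
    inside \<open>[0, h]\<close>.\<close>
  have "\<exists>s1. 0 < s1 \<and> s1 + e \<le> h \<and> s - d < s1 \<and> s1 + e < s + d"
  proof (cases "s \<le> h / 2")
    case True
    then show ?thesis using e s by (intro exI[of _ "s + e"]) auto
  next
    case False
    then show ?thesis using e s h_pos by (intro exI[of _ "s - e"]) auto
  qed
  then obtain s1 where s1: "0 < s1" "s1 + e \<le> h" "s - d < s1" "s1 + e < s + d" by blast
  show ?thesis
  proof (rule that[of s1 "s1 + e" "w s / 2"])
    fix t assume "t \<in> {s1..s1 + e}"
    then have "dist (w t) (w s) < w s / 2" using s1 by (intro d) (auto simp: dist_real_def)
    then show "w s / 2 \<le> w t" unfolding dist_real_def by linarith
  qed (use s1 s e in auto)
qed

text \<open>The translation is moved from \<open>g\<close> to the weight. What remains is the mass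
  of \<open>w\<close> near 0 and the uniform continuity of \<open>w\<close> on
  \<open>[0, h]\<close>, so the bound is relative to \<open>g x\<close> and uniform over all
  nonnegative decreasing continuous \<open>g\<close>.\<close>

lemma wavg_modulus:
  assumes "0 < \<eta>"
  obtains \<delta> where "0 < \<delta>"
    "\<And>(g :: real \<Rightarrow> real) x \<epsilon>. continuous_on UNIV g \<Longrightarrow> antimono g \<Longrightarrow> (\<And>y. 0 \<le> g y) \<Longrightarrow> 0 \<le> \<epsilon> \<Longrightarrow> \<epsilon> \<le> \<delta>
      \<Longrightarrow> wavg g x - wavg g (x + \<epsilon>) \<le> \<eta> * g x"
proof -
  obtain \<delta>1 where \<delta>1: "0 < \<delta>1" "\<delta>1 \<le> h"
    "\<And>\<epsilon>. 0 \<le> \<epsilon> \<Longrightarrow> \<epsilon> \<le> \<delta>1 \<Longrightarrow> integral {0..\<epsilon>} w \<le> \<eta> / 2"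
    using w_small_mass[of "\<eta> / 2"] assms by auto
  have "uniformly_continuous_on {0..h} w"
    by (intro compact_uniformly_continuous w_cont) auto
  moreover have "0 < \<eta> / (2 * h)" using assms h_pos by simp
  ultimately obtain \<delta>2 where \<delta>2: "0 < \<delta>2"
    "\<And>s t. s \<in> {0..h} \<Longrightarrow> t \<in> {0..h} \<Longrightarrow> dist t s < \<delta>2 \<Longrightarrow> dist (w t) (w s) < \<eta> / (2 * h)"
    unfolding uniformly_continuous_on_def by metis
  show ?thesis
  proof (rule that[of "min \<delta>1 (\<delta>2 / 2)"])
    show "0 < min \<delta>1 (\<delta>2 / 2)" using \<delta>1 \<delta>2 by auto
    fix g :: "real \<Rightarrow> real" and x \<epsilon> assume g: "continuous_on UNIV g" "antimono g" "\<And>y. 0 \<le> g y"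
      and \<epsilon>: "0 \<le> \<epsilon>" "\<epsilon> \<le> min \<delta>1 (\<delta>2 / 2)"
    have eh: "\<epsilon> \<le> h" using \<epsilon> \<delta>1 by auto
    have gc: "continuous_on A (\<lambda>s. g (c + s))" for A c
      by (intro continuous_intros continuous_on_compose2[OF g(1)]) auto
    have wc: "continuous_on {0..h - \<epsilon>} (\<lambda>s. w (s + \<epsilon>))"
      using \<epsilon> by (intro continuous_intros continuous_on_compose2[OF w_cont]) auto
    have wc': "continuous_on {0..h - \<epsilon>} w"
      using \<epsilon> by (intro continuous_on_subset[OF w_cont]) auto
    have "wavg g x = integral {0..\<epsilon>} (\<lambda>s. g (x + s) * w s) + integral {\<epsilon>..h} (\<lambda>s. g (x + s) * w s)"
      unfolding wavg_def using \<epsilon> eh wavg_integrable[OF g(1)] by (intro Henstock_Kurzweil_Integration.integral_combine[symmetric]) auto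
    moreover have "integral {\<epsilon>..h} (\<lambda>s. g (x + s) * w s)
        = integral {0..h - \<epsilon>} (\<lambda>s. g (x + \<epsilon> + s) * w (s + \<epsilon>))"
      using integral_shift_real_ivl[of \<epsilon> \<epsilon> h "\<lambda>s. g (x + s) * w s"]
      by (simp add: algebra_simps)
    \<comment> \<open>The part of the average at \<open>x + \<epsilon>\<close> that comes from
      \<open>[h - \<epsilon>, h]\<close> is nonnegative and is dropped.\<close>
    moreover have "integral {0..h - \<epsilon>} (\<lambda>s. g (x + \<epsilon> + s) * w s) \<le> wavg g (x + \<epsilon>)"
      unfolding wavg_def
      using \<epsilon> g w_nonneg w_cont
      by (intro integral_subset_le integrable_continuous_real continuous_on_mult gc wc') auto
    moreover have "integral {0..\<epsilon>} (\<lambda>s. g (x + s) * w s) \<le> \<eta> / 2 * g x"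
    proof -
      have "integral {0..\<epsilon>} (\<lambda>s. g (x + s) * w s) \<le> integral {0..\<epsilon>} (\<lambda>s. g x * w s)"
        using \<epsilon> eh g w_nonneg
        by (intro integral_le integrable_continuous_real continuous_on_mult gc continuous_on_const
            continuous_on_subset[OF w_cont] mult_right_mono) (auto simp: antimono_def)
      also have "\<dots> = g x * integral {0..\<epsilon>} w" by simp
      also have "\<dots> \<le> g x * (\<eta> / 2)" using \<epsilon> g \<delta>1 by (intro mult_left_mono) auto
      finally show ?thesis by (simp add: mult.commute)
    qed
    moreover have "integral {0..h - \<epsilon>} (\<lambda>s. g (x + \<epsilon> + s) * w (s + \<epsilon>))
        - integral {0..h - \<epsilon>} (\<lambda>s. g (x + \<epsilon> + s) * w s) \<le> \<eta> / 2 * g x"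
    proof -
      have "integral {0..h - \<epsilon>} (\<lambda>s. g (x + \<epsilon> + s) * w (s + \<epsilon>))
        - integral {0..h - \<epsilon>} (\<lambda>s. g (x + \<epsilon> + s) * w s)
        = integral {0..h - \<epsilon>} (\<lambda>s. g (x + \<epsilon> + s) * w (s + \<epsilon>) - g (x + \<epsilon> + s) * w s)"
        by (intro integral_diff[symmetric] integrable_continuous_real continuous_on_mult gc wc wc')
      also have "\<dots> \<le> integral {0..h - \<epsilon>} (\<lambda>s. g x * (\<eta> / (2 * h)))"
      proof (intro integral_le integrable_continuous_real continuous_on_diff continuous_on_mult gc wc wc'
            continuous_on_const)
        fix s assume s: "s \<in> {0..h - \<epsilon>}"
        have "dist (w (s + \<epsilon>)) (w s) < \<eta> / (2 * h)"
          using s \<epsilon> \<delta>2(1) by (intro \<delta>2) (auto simp: dist_real_def)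
        then have "g (x + \<epsilon> + s) * (w (s + \<epsilon>) - w s) \<le> g (x + \<epsilon> + s) * (\<eta> / (2 * h))"
          using g by (intro mult_left_mono) (auto simp: dist_real_def)
        also have "\<dots> \<le> g x * (\<eta> / (2 * h))"
          using g s \<epsilon> assms h_pos by (intro mult_right_mono) (auto simp: antimono_def)
        finally show "g (x + \<epsilon> + s) * w (s + \<epsilon>) - g (x + \<epsilon> + s) * w s \<le> g x * (\<eta> / (2 * h))"
          by (simp add: right_diff_distrib)
      qed
      also have "\<dots> = (h - \<epsilon>) * (g x * (\<eta> / (2 * h)))" using eh by simp
      also have "\<dots> \<le> h * (g x * (\<eta> / (2 * h)))"
        using \<epsilon> g assms h_pos by (intro mult_right_mono) auto
      finally show ?thesis using h_pos by (simp add: mult.commute)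
    qed
    ultimately show "wavg g x - wavg g (x + \<epsilon>) \<le> \<eta> * g x" by (auto simp: field_simps)
  qed
qed

text \<open>The witness is a minimum point of \<open>D (x + s)\<close> over \<open>[p, q]\<close>.
  Small averages thus force \<open>D\<close> to be small at a point whose location is prescribed up
  to \<open>q - p\<close>.\<close>

lemma wavg_pick:
  assumes s: "0 \<le> s1" "s2 \<le> h" "0 < w0" "\<And>s. s \<in> {s1..s2} \<Longrightarrow> w0 \<le> w s"
    and D: "continuous_on UNIV D" "\<And>y. 0 \<le> D y"
    and pq: "s1 \<le> p" "p < q" "q \<le> s2"
  shows "\<exists>s\<in>{p..q}. w0 * (q - p) * D (x + s) \<le> wavg D x"
proof -
  have Dc: "continuous_on A (\<lambda>s. D (x + s))" for A
    by (intro continuous_intros continuous_on_compose2[OF D(1)]) auto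
  obtain s where s': "s \<in> {p..q}" "\<And>t. t \<in> {p..q} \<Longrightarrow> D (x + s) \<le> D (x + t)"
    using continuous_attains_inf[OF _ _ Dc[of "{p..q}"]] pq by auto
  have "w0 * (q - p) * D (x + s) = integral {p..q} (\<lambda>t. D (x + s) * w0)" using pq by simp
  also have "\<dots> \<le> integral {p..q} (\<lambda>t. D (x + t) * w t)"
  proof (intro integral_le integrable_continuous_real continuous_on_mult Dc continuous_on_const)
    show "continuous_on {p..q} w" using s pq by (intro continuous_on_subset[OF w_cont]) auto
    show "D (x + s) * w0 \<le> D (x + t) * w t" if "t \<in> {p..q}" for t
      using that s' s pq D by (intro mult_mono) auto
  qed
  also have "\<dots> \<le> wavg D x"
    unfolding wavg_def using s pq D w_nonneg
    by (intro integral_subset_le integrable_continuous_real continuous_on_mult Dc continuous_on_subset[OF w_cont]) auto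
  finally show ?thesis using s' by blast
qed

lemma v_comp_cont:
  assumes "continuous_on UNIV R" "\<And>x. 0 \<le> R x" "\<And>x. R x \<le> 1"
  shows "continuous_on UNIV (\<lambda>y. v (R y))"
  by (rule continuous_on_compose2[OF v_cont assms(1)]) (use assms in auto)

section \<open>Order structure of stationary profiles\<close>

text \<open>Limits at infinity are left out and the constant is fixed to the flux at
  \<open>rp\<close>. Shifts, the constant \<open>rp\<close> and limits of discrete profiles then all
  lie in one class, whose members can be compared with each other.\<close>

definition steady :: "(real \<Rightarrow> real) \<Rightarrow> bool" where
  "steady R \<longleftrightarrow> continuous_on UNIV R \<and> mono R \<and> (\<forall>x. 0 \<le> R x \<and> R x \<le> rp) \<and>
     (\<forall>x. R x * wavg (\<lambda>y. v (R y)) x = rp * v rp)"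

lemma steadyD:
  assumes "steady R"
  shows "continuous_on UNIV R" "mono R" "0 \<le> R x" "R x \<le> rp" "R x \<le> 1"
    "R x * wavg (\<lambda>y. v (R y)) x = rp * v rp" "continuous_on UNIV (\<lambda>y. v (R y))"
    "v rp \<le> wavg (\<lambda>y. v (R y)) x" "wavg (\<lambda>y. v (R y)) x \<le> 1"
proof -
  show R: "continuous_on UNIV R" "mono R" "0 \<le> R x" "R x \<le> rp" "R x \<le> 1"
    "R x * wavg (\<lambda>y. v (R y)) x = rp * v rp" for x
    using assms rp_less by (auto simp: steady_def intro: order_trans[of "R x" rp 1])
  show c: "continuous_on UNIV (\<lambda>y. v (R y))" using R by (intro v_comp_cont) auto
  show "v rp \<le> wavg (\<lambda>y. v (R y)) x"
    using wavg_mono[of "\<lambda>_. v rp" "\<lambda>y. v (R y)" x] c R rp_less v_antimono by auto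
  show "wavg (\<lambda>y. v (R y)) x \<le> 1"
    using wavg_mono[of "\<lambda>y. v (R y)" "\<lambda>_. 1" x] c R rp_less v_bounds by auto
qed

lemma steady_const: "steady (\<lambda>_. rp)"
  using rp_pos by (auto simp: steady_def mono_def)

lemma steady_shift: "steady (\<lambda>y. R (y + a))" if "steady R"
proof -
  have "continuous_on UNIV (\<lambda>y. R (y + a))"
    by (intro continuous_intros continuous_on_compose2[OF steadyD(1)[OF that]]) auto
  then show ?thesis
    using that wavg_shift[of "\<lambda>y. v (R y)" a] by (auto simp: steady_def mono_def)
qed

text \<open>Each profile equals \<open>rp * v rp\<close> divided by its average velocity, so this is
  a difference of reciprocals. It shows that higher density ahead forces higher density at
  \<open>x\<close>.\<close>

lemma steady_diff:
  assumes "steady R1" "steady R2"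
  shows "R2 x - R1 x = rp * v rp * (wavg (\<lambda>y. v (R1 y) - v (R2 y)) x)
     / (wavg (\<lambda>y. v (R1 y)) x * wavg (\<lambda>y. v (R2 y)) x)"
proof -
  let ?B1 = "wavg (\<lambda>y. v (R1 y)) x" and ?B2 = "wavg (\<lambda>y. v (R2 y)) x"
  note 1 = steadyD[OF assms(1)] and 2 = steadyD[OF assms(2)]
  have pos: "0 < ?B1" "0 < ?B2" using 1(8)[of x] 2(8)[of x] v_rp_pos by auto
  have eq: "R1 x = rp * v rp / ?B1" "R2 x = rp * v rp / ?B2"
    using 1(6)[of x] 2(6)[of x] pos by (auto simp: field_simps)
  show ?thesis unfolding eq wavg_diff[OF 1(7) 2(7)] using pos by (simp add: field_simps)
qed

text \<open>Average velocities are at most 1, and \<open>v\<close> drops at rate at least \<beta>.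
  This is the infinitesimal form of the strong maximum principle.\<close>

lemma steady_diff_lower:
  assumes "steady R1" "steady R2" "\<And>y. R1 y \<le> R2 y"
  shows "rp * v rp * \<beta> * wavg (\<lambda>y. R2 y - R1 y) x \<le> R2 x - R1 x"
proof -
  let ?B1 = "wavg (\<lambda>y. v (R1 y)) x" and ?B2 = "wavg (\<lambda>y. v (R2 y)) x"
  let ?D = "wavg (\<lambda>y. v (R1 y) - v (R2 y)) x"
  note 1 = steadyD[OF assms(1)] and 2 = steadyD[OF assms(2)]
  have pos: "0 < ?B1" "0 < ?B2" using 1(8)[of x] 2(8)[of x] v_rp_pos by auto
  have "\<beta> * wavg (\<lambda>y. R2 y - R1 y) x = wavg (\<lambda>y. \<beta> * (R2 y - R1 y)) x"
    by (simp add: wavg_cmult)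
  also have "\<dots> \<le> ?D"
    using 1(3,5) 2(3,5) assms(3) by (intro wavg_mono v_dec continuous_intros 1(1,7) 2(1,7)) auto
  finally have D: "\<beta> * wavg (\<lambda>y. R2 y - R1 y) x \<le> ?D" .
  have D0: "0 \<le> ?D"
    using wavg_mono[of "\<lambda>_. 0" "\<lambda>y. v (R1 y) - v (R2 y)" x]
      1(3,5,7) 2(3,5,7) assms(3) v_antimono
    by (simp add: continuous_on_diff)
  have "rp * v rp * (\<beta> * wavg (\<lambda>y. R2 y - R1 y) x) \<le> rp * v rp * ?D"
    using D rp_pos v_rp_pos by (intro mult_left_mono) auto
  also have "\<dots> \<le> rp * v rp * ?D / (?B1 * ?B2)"
  proof -
    have "?B1 * ?B2 \<le> 1" using 1(9)[of x] 2(9)[of x] pos by (intro mult_le_one) auto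
    moreover have "0 \<le> rp * v rp * ?D" using D0 rp_pos v_rp_pos by auto
    ultimately show ?thesis using pos by (simp add: le_divide_eq mult_left_le)
  qed
  also have "\<dots> = R2 x - R1 x" using steady_diff[OF assms(1,2)] by simp
  finally show ?thesis by (simp add: mult.assoc)
qed

text \<open>Average velocities are at least \<open>v rp\<close>, and \<open>v\<close> drops at rate
  at most \<open>Lv\<close>. Where \<open>R1\<close> exceeds \<open>R2\<close> the velocity
  difference is nonpositive, so a majorant of the positive part of \<open>R2 - R1\<close>
  suffices.\<close>

lemma steady_diff_upper:
  assumes "steady R1" "steady R2" "continuous_on UNIV g" "\<And>y. 0 \<le> g y" "\<And>y. R2 y - R1 y \<le> g y"
  shows "R2 x - R1 x \<le> rp * Lv / v rp * wavg g x"
proof -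
  let ?B1 = "wavg (\<lambda>y. v (R1 y)) x" and ?B2 = "wavg (\<lambda>y. v (R2 y)) x"
  let ?D = "wavg (\<lambda>y. v (R1 y) - v (R2 y)) x"
  note 1 = steadyD[OF assms(1)] and 2 = steadyD[OF assms(2)]
  have pos: "0 < ?B1" "0 < ?B2" using 1(8)[of x] 2(8)[of x] v_rp_pos by auto
  have "?D \<le> wavg (\<lambda>y. Lv * g y) x"
  proof (intro wavg_mono continuous_intros 1(7) 2(7) assms(3))
    fix y
    show "v (R1 y) - v (R2 y) \<le> Lv * g y"
    proof (cases "R1 y \<le> R2 y")
      case True
      then have "v (R1 y) - v (R2 y) \<le> Lv * (R2 y - R1 y)" using 1(3,5) 2(3,5) by (intro v_lip) auto
      also have "\<dots> \<le> Lv * g y" using assms(5) Lv_pos by (intro mult_left_mono) auto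
      finally show ?thesis .
    next
      case False
      then have "v (R1 y) \<le> v (R2 y)" using 1(3,5) 2(3,5) False by (intro v_antimono) auto
      then show ?thesis using Lv_pos assms(4)[of y] by (smt (verit) mult_nonneg_nonneg)
    qed
  qed
  then have D: "?D \<le> Lv * wavg g x" by (simp add: wavg_cmult)
  have g0: "0 \<le> wavg g x" using wavg_mono[of "\<lambda>_. 0" g x] assms by auto
  have "R2 x - R1 x = rp * v rp * ?D / (?B1 * ?B2)" using steady_diff[OF assms(1,2)] by simp
  also have "\<dots> \<le> rp * v rp * (Lv * wavg g x) / (?B1 * ?B2)"
    using D rp_pos v_rp_pos pos by (intro divide_right_mono mult_left_mono) auto
  also have "\<dots> \<le> rp * v rp * (Lv * wavg g x) / (v rp * v rp)"
    using g0 Lv_pos rp_pos v_rp_pos pos 1(8)[of x] 2(8)[of x]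
    by (intro divide_left_mono mult_mono mult_nonneg_nonneg mult_pos_pos) auto
  also have "\<dots> = rp * Lv / v rp * wavg g x" using v_rp_pos by simp
  finally show ?thesis .
qed

text \<open>The ordering is extended to the left by a fixed \<delta> at a time. At a maximum point
  of the violation \<open>g\<close> on the new piece, only weight from \<open>[0, \<delta>]\<close>
  meets nonzero values of \<open>g\<close>; its mass is so small that the maximum is at most half of
  itself, hence zero.\<close>

lemma steady_order_back:
  assumes "steady R1" "steady R2" "\<And>y. X \<le> y \<Longrightarrow> y \<le> X + h \<Longrightarrow> R1 y \<le> R2 y"
  assumes "y \<le> X + h"
  shows "R1 y \<le> R2 y"
proof -
  note 1 = steadyD[OF assms(1)] and 2 = steadyD[OF assms(2)]
  define C where "C = rp * Lv / v rp"
  have C: "0 < C" using rp_pos Lv_pos v_rp_pos by (simp add: C_def)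
  obtain \<delta> where \<delta>: "0 < \<delta>" "\<delta> \<le> h" "\<And>\<epsilon>. 0 \<le> \<epsilon> \<Longrightarrow> \<epsilon> \<le> \<delta> \<Longrightarrow> integral {0..\<epsilon>} w \<le> 1 / (2 * C)"
    using w_small_mass[of "1 / (2 * C)"] C by auto
  define g where "g y = max 0 (R1 y - R2 y)" for y
  have gc: "continuous_on A g" for A
    unfolding g_def by (intro continuous_intros continuous_on_subset[OF 1(1)] continuous_on_subset[OF 2(1)]) auto
  have step: "\<forall>y\<in>{X' - \<delta>..X + h}. R1 y \<le> R2 y"
    if ord: "\<forall>y\<in>{X'..X + h}. R1 y \<le> R2 y" and X': "X' \<le> X" for X'
  proof -
    obtain z where z: "z \<in> {X' - \<delta>..X'}" "\<And>y. y \<in> {X' - \<delta>..X'} \<Longrightarrow> g y \<le> g z"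
      using continuous_attains_sup[OF _ _ gc[of "{X' - \<delta>..X'}"]] \<delta> by auto
    have gz: "0 \<le> g z" by (simp add: g_def)
    have zero: "g y = 0" if "y \<in> {X'..X + h}" for y using ord that by (auto simp: g_def)
    have "wavg g z \<le> g z * (1 / (2 * C))"
    proof -
      have "wavg g z = integral {0..\<delta>} (\<lambda>s. g (z + s) * w s) + integral {\<delta>..h} (\<lambda>s. g (z + s) * w s)"
        unfolding wavg_def using \<delta> wavg_integrable[OF gc]
        by (intro Henstock_Kurzweil_Integration.integral_combine[symmetric]) auto
      \<comment> \<open>Since \<open>z + \<delta>\<close> is at least \<open>X'\<close> and
        \<open>z + h\<close> at most \<open>X + h\<close>, the ordering is already known on this
        range.\<close>
      moreover have "integral {\<delta>..h} (\<lambda>s. g (z + s) * w s) = integral {\<delta>..h} (\<lambda>_. 0)"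
        using z(1) X' by (intro integral_cong) (auto intro!: zero)
      moreover have "integral {0..\<delta>} (\<lambda>s. g (z + s) * w s) \<le> integral {0..\<delta>} (\<lambda>s. g z * w s)"
      proof (intro integral_le integrable_on_subinterval[OF wavg_integrable[OF gc]] integrable_on_mult_right
          w_integrable mult_right_mono w_nonneg)
        fix s assume s: "s \<in> {0..\<delta>}"
        show "g (z + s) \<le> g z"
        proof (cases "z + s \<le> X'")
          case True
          then show ?thesis using s z by (intro z(2)) auto
        next
          case False
          then show ?thesis using s z X' gz \<delta> by (subst zero) auto
        qed
      qed (use \<delta> in auto)
      moreover have "integral {0..\<delta>} (\<lambda>s. g z * w s) \<le> g z * (1 / (2 * C))"
        using \<delta>(3)[of \<delta>] \<delta>(1) gz by (simp del: times_divide_eq_right) (intro mult_left_mono; simp)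
      ultimately show ?thesis by simp
    qed
    moreover have "R1 z - R2 z \<le> C * wavg g z"
      unfolding C_def using gc by (intro steady_diff_upper assms(1,2)) (auto simp: g_def)
    moreover have "C * wavg g z \<le> C * (g z * (1 / (2 * C)))"
      using calculation C by (intro mult_left_mono) auto
    ultimately have "R1 z - R2 z \<le> g z / 2" using C by (simp add: field_simps)
    then have "g z = 0" by (auto simp: g_def)
    then have "g y = 0" if "y \<in> {X' - \<delta>..X + h}" for y
      using that z(2)[of y] zero[of y] by (cases "y \<le> X'") (auto simp: g_def)
    then have "R1 y \<le> R2 y" if "y \<in> {X' - \<delta>..X + h}" for y
      using that unfolding g_def by (smt (verit))
    then show ?thesis by blast
  qed
  have all: "\<forall>y\<in>{X - real n * \<delta>..X + h}. R1 y \<le> R2 y" for n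
  proof (induction n)
    case 0
    then show ?case using assms(3) by auto
  next
    case (Suc n)
    moreover have "X - real (Suc n) * \<delta> = X - real n * \<delta> - \<delta>" by (simp add: algebra_simps)
    ultimately show ?case using step[of "X - real n * \<delta>"] \<delta>(1) by simp
  qed
  obtain n where "X - y < real n * \<delta>" using ex_less_of_nat_mult[OF \<delta>(1)] by blast
  then have "y \<in> {X - real n * \<delta>..X + h}" using assms(4) by simp
  then show ?thesis using all[of n] by (rule bspec[rotated])
qed

text \<open>Once \<open>rp\<close> is attained, monotonicity keeps it to the right, and comparison
  with the constant profile \<open>rp\<close> carries it to the left.\<close>

lemma steady_less_rp:
  assumes "steady R" "R z < rp"
  shows "R x < rp"
proof (rule ccontr)
  assume "\<not> R x < rp"
  then have x: "rp \<le> R y" if "x \<le> y" for y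
    using monoD[OF steadyD(2)[OF assms(1)] that] by simp
  have "rp \<le> R z"
  proof (cases "x \<le> z")
    case False
    show ?thesis
      by (rule steady_order_back[OF steady_const assms(1), of x z]) (use x h_pos False in auto)
  qed (use x in auto)
  then show False using assms by simp
qed

end

section \<open>Propagation, decay and the Harnack inequality\<close>

text \<open>The target is reached by \<open>N\<close> steps of nearly equal length: each lies in
  \<open>[p, q]\<close>, where \<open>p\<close> is the mean step to \<open>a\<close> and
  \<open>q\<close> the mean step to \<open>a + \<eta>\<close>. Every step costs a factor
  \<open>c * (q - p)\<close>.\<close>

lemma positive_propagation:
  fixes D :: "real \<Rightarrow> real"
  assumes step: "\<And>x p q. s1 \<le> p \<Longrightarrow> p < q \<Longrightarrow> q \<le> s2 \<Longrightarrow> \<exists>s\<in>{p..q}. c * (q - p) * D (x + s) \<le> D x"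
    and "0 < c" "0 < \<eta>" "0 < N" and a: "x + real N * s1 \<le> a" "a + \<eta> \<le> x + real N * s2"
  shows "\<exists>y\<in>{a..a + \<eta>}. (c * \<eta> / real N) ^ N * D y \<le> D x"
proof -
  define p q where "p = (a - x) / real N" and "q = p + \<eta> / real N"
  have pq: "s1 \<le> p" "p < q" "q \<le> s2" "x + real N * p = a" "x + real N * q = a + \<eta>"
    using assms(3,4) a by (auto simp: p_def q_def field_simps)
  have "\<exists>y\<in>{x + real k * p..x + real k * q}. (c * (q - p)) ^ k * D y \<le> D x" for k
  proof (induction k)
    case 0
    then show ?case by auto
  next
    case (Suc k)
    then obtain y where y: "x + real k * p \<le> y" "y \<le> x + real k * q" "(c * (q - p)) ^ k * D y \<le> D x" by auto
    obtain s where s: "p \<le> s" "s \<le> q" "c * (q - p) * D (y + s) \<le> D y" using step[OF pq(1-3), of y] by auto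
    have "(c * (q - p)) ^ Suc k * D (y + s) = (c * (q - p)) ^ k * (c * (q - p) * D (y + s))" by simp
    also have "\<dots> \<le> (c * (q - p)) ^ k * D y" using s pq assms(2) by (intro mult_left_mono) auto
    finally have "(c * (q - p)) ^ Suc k * D (y + s) \<le> D x" using y by linarith
    moreover have "y + s \<in> {x + real (Suc k) * p..x + real (Suc k) * q}"
      using y s by (auto simp: algebra_simps)
    ultimately show ?case by blast
  qed
  from this[of N] show ?thesis by (simp add: pq(4,5)) (simp add: q_def)
qed

lemma increment_chain:
  fixes R :: "real \<Rightarrow> real"
  assumes "mono R" "0 < \<delta>" "0 \<le> h" "0 \<le> e"
    and "\<And>t. T \<le> t \<Longrightarrow> t \<le> T + h \<Longrightarrow> R (t + \<delta>) - R t \<le> e"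
  shows "R (T + h) - R T \<le> (h / \<delta> + 1) * e"
proof -
  \<comment> \<open>Rounding up covers the length \<open>h\<close>, while each step used still
    starts inside \<open>[T, T + h]\<close>.\<close>
  define n where "n = nat \<lceil>h / \<delta>\<rceil>"
  have "0 \<le> h / \<delta>" using assms by simp
  then have n: "h / \<delta> \<le> real n" "real n \<le> h / \<delta> + 1" "\<And>k. k < n \<Longrightarrow> real k \<le> h / \<delta>"
    unfolding n_def by linarith+
  have "R (T + real k * \<delta>) - R T \<le> real k * e" if "k \<le> n" for k
    using that
  proof (induction k)
    case (Suc k)
    have "R (T + real k * \<delta> + \<delta>) - R (T + real k * \<delta>) \<le> e"
      using n(3)[of k] Suc.prems assms(2) by (intro assms(5)) (auto simp: field_simps)
    then show ?case using Suc by (simp add: algebra_simps)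
  qed simp
  from this[of n] have "R (T + real n * \<delta>) - R T \<le> real n * e" by simp
  moreover have "R (T + h) \<le> R (T + real n * \<delta>)"
    using n(1) assms(2) by (intro monoD[OF assms(1)]) (simp add: field_simps)
  moreover have "real n * e \<le> (h / \<delta> + 1) * e" using n assms by (intro mult_right_mono) auto
  ultimately show ?thesis by linarith
qed

context nonlocal_traffic
begin

text \<open>This is the strong maximum principle in quantitative form: near contact of two ordered
  profiles at \<open>x\<close> produces near contact in any short interval between
  \<open>x + N * s1\<close> and \<open>x + N * s2\<close>. The constants do not depend on the
  profiles.\<close>

lemma steady_propagation:
  obtains c s1 s2 where "0 < c" "0 < s1" "s1 < s2"
    "\<And>R1 R2 N \<eta> x a. steady R1 \<Longrightarrow> steady R2 \<Longrightarrow> (\<And>y. R1 y \<le> R2 y) \<Longrightarrow> 0 < \<eta> \<Longrightarrow> 0 < N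
      \<Longrightarrow> x + real N * s1 \<le> a \<Longrightarrow> a + \<eta> \<le> x + real N * s2
      \<Longrightarrow> \<exists>y\<in>{a..a + \<eta>}. (c * \<eta> / real N) ^ N * (R2 y - R1 y) \<le> R2 x - R1 x"
proof -
  obtain s1 s2 w0 where s: "0 < s1" "s1 < s2" "s2 \<le> h" "0 < w0" "\<And>s. s \<in> {s1..s2} \<Longrightarrow> w0 \<le> w s"
    using w_positive_interval by blast
  define c where "c = rp * v rp * \<beta> * w0"
  have pos: "0 < rp * v rp * \<beta>" using rp_pos v_rp_pos \<beta>_pos by simp
  have c: "0 < c" using s pos by (simp add: c_def)
  show ?thesis
  proof (rule that[OF c s(1,2)])
    fix R1 R2 N \<eta> x a
    assume R: "steady R1" "steady R2" "\<And>y. R1 y \<le> R2 y"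
      and *: "0 < \<eta>" "0 < N" "x + real N * s1 \<le> a" "a + \<eta> \<le> x + real N * s2"
    show "\<exists>y\<in>{a..a + \<eta>}. (c * \<eta> / real N) ^ N * (R2 y - R1 y) \<le> R2 x - R1 x"
    proof (rule positive_propagation[where D = "\<lambda>y. R2 y - R1 y", OF _ c *])
      fix x p q assume pq: "s1 \<le> p" "p < q" "q \<le> s2"
      have "\<exists>s\<in>{p..q}. w0 * (q - p) * (R2 (x + s) - R1 (x + s)) \<le> wavg (\<lambda>y. R2 y - R1 y) x"
        using R(3) s pq steadyD(1)[OF R(1)] steadyD(1)[OF R(2)]
        by (intro wavg_pick[of s1 s2 w0 "\<lambda>y. R2 y - R1 y"]) (auto intro!: continuous_intros)
      then obtain t where t: "t \<in> {p..q}"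
        "w0 * (q - p) * (R2 (x + t) - R1 (x + t)) \<le> wavg (\<lambda>y. R2 y - R1 y) x" by blast
      have "c * (q - p) * (R2 (x + t) - R1 (x + t))
          = rp * v rp * \<beta> * (w0 * (q - p) * (R2 (x + t) - R1 (x + t)))" by (simp add: c_def)
      also have "\<dots> \<le> rp * v rp * \<beta> * wavg (\<lambda>y. R2 y - R1 y) x"
        using t pos by (intro mult_left_mono) auto
      also have "\<dots> \<le> R2 x - R1 x" by (rule steady_diff_lower[OF R])
      finally show "\<exists>s\<in>{p..q}. c * (q - p) * (R2 (x + s) - R1 (x + s)) \<le> R2 x - R1 x"
        using t by blast
    qed
  qed
qed

text \<open>Comparison with the constant profile bounds the deficit \<open>rp - R x\<close> by
  \<open>A\<close> times its average. Moving the average to \<open>x + \<delta>\<close> costs at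
  most half of the deficit at \<open>x\<close>, which is absorbed on the left. Iteration reaches any
  distance \<open>T\<close>.\<close>

lemma steady_harnack:
  assumes "0 \<le> T"
  obtains C where "0 < C" "\<And>R x. steady R \<Longrightarrow> rp - R x \<le> C * (rp - R (x + T))"
proof -
  define A where "A = rp * Lv / v rp"
  have A: "0 < A" using rp_pos Lv_pos v_rp_pos by (simp add: A_def)
  then have "0 < 1 / (2 * A)" by simp
  then obtain \<delta> where \<delta>: "0 < \<delta>" and mod:
    "\<And>(g :: real \<Rightarrow> real) x \<epsilon>. continuous_on UNIV g \<Longrightarrow> antimono g \<Longrightarrow> (\<And>y. 0 \<le> g y) \<Longrightarrow> 0 \<le> \<epsilon> \<Longrightarrow> \<epsilon> \<le> \<delta>
      \<Longrightarrow> wavg g x - wavg g (x + \<epsilon>) \<le> 1 / (2 * A) * g x"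
    using wavg_modulus by metis
  have step: "rp - R x \<le> 2 * A * (rp - R (x + \<delta>))" if R: "steady R" for R x
  proof -
    note RD = steadyD[OF R]
    have gc: "continuous_on UNIV (\<lambda>y. rp - R y)" by (intro continuous_intros RD)
    have ga: "antimono (\<lambda>y. rp - R y)" using RD(2) by (auto simp: antimono_def mono_def)
    have upper: "rp - R x \<le> A * wavg (\<lambda>y. rp - R y) x"
      unfolding A_def using RD(4) by (intro steady_diff_upper[OF R steady_const gc]) auto
    have "wavg (\<lambda>y. rp - R y) x \<le> 1 / (2 * A) * (rp - R x) + (rp - R (x + \<delta>))"
      using mod[OF gc ga, of \<delta> x] wavg_bounds(2)[OF gc ga, of "x + \<delta>"] RD(4) \<delta> by auto
    then have "A * wavg (\<lambda>y. rp - R y) x \<le> A * (1 / (2 * A) * (rp - R x) + (rp - R (x + \<delta>)))"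
      using A by (intro mult_left_mono) auto
    also have "\<dots> = (rp - R x) / 2 + A * (rp - R (x + \<delta>))" using A by (simp add: field_simps)
    finally have "rp - R x \<le> (rp - R x) / 2 + A * (rp - R (x + \<delta>))" using upper by (rule order_trans[rotated])
    then show ?thesis by (simp add: field_simps)
  qed
  have iter: "rp - R x \<le> (2 * A) ^ n * (rp - R (x + real n * \<delta>))" if R: "steady R" for R x n
  proof (induction n)
    case (Suc n)
    have "(2 * A) ^ n * (rp - R (x + real n * \<delta>)) \<le> (2 * A) ^ n * (2 * A * (rp - R (x + real n * \<delta> + \<delta>)))"
      using A by (intro mult_left_mono step R) auto
    then show ?case using Suc by (simp add: algebra_simps)
  qed simp
  obtain n where n: "T < real n * \<delta>" using ex_less_of_nat_mult[OF \<delta>(1)] by blast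
  show ?thesis
  proof (rule that[of "(2 * A) ^ n"])
    fix R x assume R: "steady R"
    have "R (x + T) \<le> R (x + real n * \<delta>)" using n by (intro monoD[OF steadyD(2)[OF R]]) auto
    then have "(2 * A) ^ n * (rp - R (x + real n * \<delta>)) \<le> (2 * A) ^ n * (rp - R (x + T))"
      using A by (intro mult_left_mono) auto
    then show "rp - R x \<le> (2 * A) ^ n * (rp - R (x + T))" using iter[OF R, of x n] by linarith
  qed (use A in auto)
qed

text \<open>Subtracting \<open>v rp\<close> from \<open>v (R y)\<close> leaves increments of the
  average unchanged, but makes the relative bound of \<open>wavg_modulus\<close> proportional to
  \<open>rp - R x\<close>. An absolute modulus would be useless far to the right, where all deficits
  are tiny.\<close>

lemma steady_modulus:
  assumes "0 < \<eta>"
  obtains \<delta> where "0 < \<delta>" "\<And>R x \<epsilon>. steady R \<Longrightarrow> 0 \<le> \<epsilon> \<Longrightarrow> \<epsilon> \<le> \<delta> \<Longrightarrow> R (x + \<epsilon>) - R x \<le> \<eta> * (rp - R x)"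
proof -
  define \<eta>' where "\<eta>' = \<eta> * v rp / (rp * Lv)"
  have \<eta>': "0 < \<eta>'" using assms rp_pos Lv_pos v_rp_pos by (simp add: \<eta>'_def)
  then obtain \<delta> where \<delta>: "0 < \<delta>" and mod:
    "\<And>(g :: real \<Rightarrow> real) x \<epsilon>. continuous_on UNIV g \<Longrightarrow> antimono g \<Longrightarrow> (\<And>y. 0 \<le> g y) \<Longrightarrow> 0 \<le> \<epsilon> \<Longrightarrow> \<epsilon> \<le> \<delta>
      \<Longrightarrow> wavg g x - wavg g (x + \<epsilon>) \<le> \<eta>' * g x"
    using wavg_modulus by metis
  show ?thesis
  proof (rule that[OF \<delta>])
    fix R x \<epsilon> assume R: "steady R" and \<epsilon>: "0 \<le> \<epsilon>" "\<epsilon> \<le> \<delta>"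
    note RD = steadyD[OF R]
    note Re = steady_shift[OF R, of \<epsilon>]
    let ?g = "\<lambda>y. v (R y) - v rp"
    let ?B1 = "wavg (\<lambda>y. v (R y)) x" and ?B2 = "wavg (\<lambda>y. v (R (y + \<epsilon>))) x"
    have gc: "continuous_on UNIV ?g" by (intro continuous_intros RD)
    have ga: "antimono ?g"
      using RD(2,3,5) v_antimono by (auto simp: antimono_def mono_def)
    have g0: "0 \<le> ?g y" for y using RD(3,4) rp_less v_antimono by auto
    have pos: "0 < ?B1" "0 < ?B2" using RD(8)[of x] steadyD(8)[OF Re, of x] v_rp_pos by auto
    have "wavg (\<lambda>y. v (R y) - v (R (y + \<epsilon>))) x = wavg ?g x - wavg ?g (x + \<epsilon>)"
      using wavg_diff[OF RD(7) steadyD(7)[OF Re], of x] wavg_shift[of "\<lambda>y. v (R y)" \<epsilon> x]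
        wavg_diff[OF RD(7) continuous_on_const, of "v rp"] by simp
    also have "\<dots> \<le> \<eta>' * ?g x" by (intro mod gc ga g0 \<epsilon>)
    also have "\<dots> \<le> \<eta>' * (Lv * (rp - R x))"
      using \<eta>' RD(3,4) rp_less by (intro mult_left_mono v_lip) auto
    finally have *: "wavg (\<lambda>y. v (R y) - v (R (y + \<epsilon>))) x \<le> \<eta>' * (Lv * (rp - R x))" .
    have "R (x + \<epsilon>) - R x = rp * v rp * wavg (\<lambda>y. v (R y) - v (R (y + \<epsilon>))) x / (?B1 * ?B2)"
      by (rule steady_diff[OF R Re])
    also have "\<dots> \<le> rp * v rp * (\<eta>' * (Lv * (rp - R x))) / (?B1 * ?B2)"
      using * rp_pos v_rp_pos pos by (intro divide_right_mono mult_left_mono) auto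
    also have "\<dots> \<le> rp * v rp * (\<eta>' * (Lv * (rp - R x))) / (v rp * v rp)"
      using \<eta>' Lv_pos rp_pos v_rp_pos pos RD(4,8)[of x] steadyD(8)[OF Re, of x]
      by (intro divide_left_mono mult_mono mult_nonneg_nonneg mult_pos_pos) auto
    also have "\<dots> = \<eta> * (rp - R x)" using v_rp_pos rp_pos Lv_pos by (simp add: \<eta>'_def)
    finally show "R (x + \<epsilon>) - R x \<le> \<eta> * (rp - R x)" .
  qed
qed

end

text \<open>The inequality \<open>slope\<close> is the negative slope of the flux at
  \<open>rp\<close> in chord form: dividing by \<open>rp - q\<close> and letting \<open>q\<close>
  tend to \<open>rp\<close> turns it into a bound on the derivative of \<open>v\<close>.\<close>

locale nonlocal_traffic_congested = nonlocal_traffic +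
  fixes \<kappa> q0 :: real
  assumes \<kappa>: "1 < \<kappa>" and q0: "q0 < rp"
    and slope: "\<And>q. q0 \<le> q \<Longrightarrow> q \<le> rp \<Longrightarrow> \<kappa> * (rp - q) * v q \<le> rp * (v q - v rp)"
begin

text \<open>The average velocity at \<open>x\<close> is at least \<open>v (R (x + h))\<close>, so
  \<open>R x * v (R (x + h))\<close> is at most the flux at \<open>rp\<close>. The chord inequality
  at \<open>R (x + h)\<close> then yields the factor \<kappa> once the profile exceeds
  \<open>q0\<close>.\<close>

lemma steady_decay:
  assumes R: "steady R" and lim: "(R \<longlongrightarrow> rp) at_top"
  obtains X where "\<And>x n. X \<le> x \<Longrightarrow> \<kappa> ^ n * (rp - R (x + real n * h)) \<le> rp - R x"
proof -
  note RD = steadyD[OF R]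
  have "\<forall>\<^sub>F x in at_top. q0 < R x" using order_tendstoD(1)[OF lim q0] .
  then obtain X where X: "\<And>x. X \<le> x \<Longrightarrow> q0 < R x" by (auto simp: eventually_at_top_linorder)
  have step: "\<kappa> * (rp - R (x + h)) \<le> rp - R x" if x: "X \<le> x" for x
  proof -
    let ?q = "R (x + h)"
    have q: "q0 \<le> ?q" "?q \<le> rp" using X[of "x + h"] x h_pos RD(4) by auto
    have vq: "0 < v ?q" using v_antimono[of ?q rp] q RD(3) rp_less v_rp_pos by (smt (verit))
    have "antimono (\<lambda>y. v (R y))" using RD(2,3,5) v_antimono by (auto simp: antimono_def mono_def)
    then have "v ?q \<le> wavg (\<lambda>y. v (R y)) x" using wavg_bounds(1)[OF RD(7)] by blast
    then have "R x * v ?q \<le> R x * wavg (\<lambda>y. v (R y)) x" using RD(3) by (intro mult_left_mono)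
    also have "\<dots> = rp * v rp" by (rule RD(6))
    finally have "\<kappa> * (rp - ?q) * v ?q \<le> (rp - R x) * v ?q"
      using slope[OF q] by (simp add: algebra_simps)
    then show ?thesis using vq by simp
  qed
  show ?thesis
  proof (rule that)
    fix x n assume x: "X \<le> x"
    show "\<kappa> ^ n * (rp - R (x + real n * h)) \<le> rp - R x"
    proof (induction n)
      case (Suc n)
      have "\<kappa> ^ n * (\<kappa> * (rp - R (x + real n * h + h))) \<le> \<kappa> ^ n * (rp - R (x + real n * h))"
        using \<kappa> x h_pos by (intro mult_left_mono step) (auto intro: add_increasing2)
      then show ?case using Suc by (simp add: algebra_simps)
    qed simp
  qed
qed

text \<open>If \<open>R\<close> is flat on \<open>[a, b]\<close>, then \<open>R\<close> and its
  shift by \<open>b - a\<close> touch at \<open>a\<close>. Touching propagates to the right and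
  flattens \<open>R\<close> on a whole window of length \<open>h\<close>, against the decay of the
  deficit.\<close>

lemma steady_strict_mono:
  assumes R: "steady R" and lim: "(R \<longlongrightarrow> rp) at_top" and z: "R z < rp"
  shows "strict_mono R"
proof (rule strict_monoI, rule ccontr)
  fix a b :: real assume ab: "a < b" and "\<not> R a < R b"
  note RD = steadyD[OF R]
  have eq: "R b = R a" using monoD[OF RD(2), of a b] ab \<open>\<not> R a < R b\<close> by simp
  define \<delta> where "\<delta> = b - a"
  have \<delta>: "0 < \<delta>" using ab by (simp add: \<delta>_def)
  have ord: "R y \<le> R (y + \<delta>)" for y using \<delta> by (intro monoD[OF RD(2)]) auto
  obtain c s1 s2 where c: "0 < c" "0 < s1" "s1 < s2" and propagate:
    "\<And>R1 R2 N \<eta> x a. steady R1 \<Longrightarrow> steady R2 \<Longrightarrow> (\<And>y. R1 y \<le> R2 y) \<Longrightarrow> 0 < \<eta> \<Longrightarrow> 0 < N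
      \<Longrightarrow> x + real N * s1 \<le> a \<Longrightarrow> a + \<eta> \<le> x + real N * s2
      \<Longrightarrow> \<exists>y\<in>{a..a + \<eta>}. (c * \<eta> / real N) ^ N * (R2 y - R1 y) \<le> R2 x - R1 x"
    using steady_propagation by metis
  obtain X where X: "\<And>x n. X \<le> x \<Longrightarrow> \<kappa> ^ n * (rp - R (x + real n * h)) \<le> rp - R x"
    using steady_decay[OF R lim] by blast
  \<comment> \<open>\<open>N1\<close> makes the reachable range longer than the window plus the
    shift; \<open>N2\<close> places its beginning where the decay holds.\<close>
  obtain N1 where N1: "h + \<delta> < real N1 * (s2 - s1)" using ex_less_of_nat_mult[of "s2 - s1"] c by auto
  obtain N2 where N2: "X - a < real N2 * s1" using ex_less_of_nat_mult[of s1] c by auto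
  define N where "N = N1 + N2 + 1"
  have N: "0 < N" "h + \<delta> < real N * (s2 - s1)" "X - a < real N * s1"
  proof -
    have "real N1 * (s2 - s1) \<le> real N * (s2 - s1)" "real N2 * s1 \<le> real N * s1"
      using c by (auto intro!: mult_right_mono simp: N_def)
    then show "h + \<delta> < real N * (s2 - s1)" "X - a < real N * s1" using N1 N2 by linarith+
  qed (simp add: N_def)
  define T where "T = a + real N * s1 + \<delta> / 2"
  have XT: "X \<le> T" using N \<delta> by (simp add: T_def)
  have "R (t + \<delta> / 2) - R t \<le> 0" if t: "T \<le> t" "t \<le> T + h" for t
  proof -
    have "\<exists>y\<in>{t - \<delta> / 2..t - \<delta> / 2 + \<delta> / 2}. (c * (\<delta> / 2) / real N) ^ N * (R (y + \<delta>) - R y) \<le> R (a + \<delta>) - R a"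
      using N t \<delta> by (intro propagate R steady_shift ord) (auto simp: T_def algebra_simps)
    then obtain y where y: "t - \<delta> / 2 \<le> y" "y \<le> t" "(c * (\<delta> / 2) / real N) ^ N * (R (y + \<delta>) - R y) \<le> 0"
      using eq by (auto simp: \<delta>_def)
    have "0 < (c * (\<delta> / 2) / real N) ^ N" using c \<delta> N by simp
    then have "R (y + \<delta>) - R y \<le> 0" using y by (simp add: mult_le_0_iff)
    moreover have "R (t + \<delta> / 2) \<le> R (y + \<delta>)" "R y \<le> R t" using y by (auto intro!: monoD[OF RD(2)])
    ultimately show ?thesis by linarith
  qed
  then have "R (T + h) - R T \<le> (h / (\<delta> / 2) + 1) * 0"
    using \<delta> h_pos by (intro increment_chain RD(2)) auto
  then have "R (T + h) \<le> R T" by simp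
  moreover have "\<kappa> * (rp - R (T + h)) \<le> rp - R T" using X[OF XT, of 1] by simp
  moreover have "0 < rp - R (T + h)" using steady_less_rp[OF R z] by simp
  then have "1 * (rp - R (T + h)) < \<kappa> * (rp - R (T + h))" using \<kappa> by (intro mult_strict_right_mono) auto
  ultimately show False by simp
qed

section \<open>Uniqueness of stationary profiles\<close>

text \<open>Matching \<open>R1 X\<close> with a value of \<open>R2\<close> gives shift bounds to the
  left of \<open>X\<close>. Harnack for \<open>R1\<close> and decay for \<open>R2\<close> compare
  the values over one window; strict monotonicity shows that the matching shift stays bounded as
  \<open>X\<close> grows.\<close>

lemma steady_shift_bounds:
  assumes R1: "steady R1" "(R1 \<longlongrightarrow> rp) at_top" and R2: "steady R2" "(R2 \<longlongrightarrow> rp) at_top"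
    and eq0: "R1 0 = R2 0" and less: "R2 0 < rp"
  obtains A B where "\<And>y. R1 y \<le> R2 (y + A)" "\<And>y. R2 (y + B) \<le> R1 y"
proof -
  note D1 = steadyD[OF R1(1)] and D2 = steadyD[OF R2(1)]
  have lt1: "R1 x < rp" for x using steady_less_rp[OF R1(1), of 0] eq0 less by simp
  have lt2: "R2 x < rp" for x using steady_less_rp[OF R2(1) less] by simp
  have strict: "strict_mono R2" by (rule steady_strict_mono[OF R2 less])
  obtain C where C: "0 < C" "\<And>R x. steady R \<Longrightarrow> rp - R x \<le> C * (rp - R (x + h))"
    using steady_harnack[of h] h_pos by auto
  obtain X0 where X0: "\<And>x n. X0 \<le> x \<Longrightarrow> \<kappa> ^ n * (rp - R2 (x + real n * h)) \<le> rp - R2 x"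
    using steady_decay[OF R2] by blast
  obtain n where n: "C < \<kappa> ^ n" using real_arch_pow[OF \<kappa>] by blast
  have "\<forall>\<^sub>F x in at_top. R2 (X0 + real n * h) < R1 x" using order_tendstoD(1)[OF R1(2) lt2] .
  then obtain X1' where X1': "\<And>x. X1' \<le> x \<Longrightarrow> R2 (X0 + real n * h) < R1 x"
    by (auto simp: eventually_at_top_linorder)
  define X1 where "X1 = max 0 X1'"
  have key: "\<exists>\<alpha>. (\<forall>y\<le>X. R2 (y + (\<alpha> - real n * h)) \<le> R1 y) \<and> (\<forall>y\<le>X. R1 y \<le> R2 (y + (\<alpha> + h)))"
    if X: "X1 \<le> X" for X
  proof -
    have "\<forall>\<^sub>F x in at_top. R1 X < R2 x \<and> 0 \<le> x"
      by (intro eventually_conj order_tendstoD(1)[OF R2(2) lt1] eventually_ge_at_top)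
    then obtain b where b: "R1 X < R2 b" "0 \<le> b" by (auto simp: eventually_at_top_linorder)
    have "R2 0 \<le> R1 X" using monoD[OF D1(2), of 0 X] X eq0 by (simp add: X1_def)
    then obtain z where z: "R2 z = R1 X"
      \<comment> \<open>The common value at 0 and \<open>X1\<close> being nonnegative supply the
        lower end for the intermediate value theorem.\<close>
      using IVT'[of R2 0 "R1 X" b] b continuous_on_subset[OF D2(1)] by force
    have "X0 + real n * h < z"
      using X1'[of X] X z monoD[OF D2(2), of z "X0 + real n * h"] by (force simp: X1_def)
    then have "\<kappa> ^ n * (rp - R1 X) \<le> rp - R2 (z - real n * h)"
      using X0[of "z - real n * h" n] z by simp
    moreover have "rp - R1 (X - h) \<le> C * (rp - R1 X)" using C(2)[OF R1(1), of "X - h"] by simp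
    moreover have "C * (rp - R1 X) \<le> \<kappa> ^ n * (rp - R1 X)"
      using n lt1[of X] by (intro mult_right_mono) auto
    \<comment> \<open>Over \<open>n\<close> lengths the deficit of \<open>R2\<close> grows to the
      left by at least \<open>\<kappa> ^ n\<close>, which exceeds the growth \<open>C\<close> that
      Harnack allows \<open>R1\<close> over one length.\<close>
    ultimately have low: "R2 (z - real n * h) \<le> R1 (X - h)" by linarith
    have "R2 (y + (z - X - real n * h)) \<le> R1 y" if "y \<le> X" for y
    proof (rule steady_order_back[OF steady_shift[OF R2(1)] R1(1), of "X - h"])
      fix y assume y: "X - h \<le> y" "y \<le> X - h + h"
      have "R2 (y + (z - X - real n * h)) \<le> R2 (z - real n * h)" using y by (intro monoD[OF D2(2)]) auto
      also have "\<dots> \<le> R1 (X - h)" by (rule low)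
      also have "\<dots> \<le> R1 y" using y by (intro monoD[OF D1(2)])
      finally show "R2 (y + (z - X - real n * h)) \<le> R1 y" .
    qed (use that in simp)
    moreover have "R1 y \<le> R2 (y + (z - X + h))" if "y \<le> X" for y
    proof (rule steady_order_back[OF R1(1) steady_shift[OF R2(1)], of "X - h"])
      fix y assume y: "X - h \<le> y" "y \<le> X - h + h"
      have "R1 y \<le> R1 X" using y by (intro monoD[OF D1(2)]) auto
      also have "\<dots> = R2 z" by (simp add: z)
      also have "\<dots> \<le> R2 (y + (z - X + h))" using y by (intro monoD[OF D2(2)]) auto
      finally show "R1 y \<le> R2 (y + (z - X + h))" .
    qed (use that in simp)
    ultimately show ?thesis by blast
  qed
  obtain a where a: "\<And>y. y \<le> X1 \<Longrightarrow> R2 (y + (a - real n * h)) \<le> R1 y" "\<And>y. y \<le> X1 \<Longrightarrow> R1 y \<le> R2 (y + (a + h))"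
    using key[of X1] by auto
  have key': "R2 (y + (a - 2 * real n * h - h)) \<le> R1 y \<and> R1 y \<le> R2 (y + (a + real n * h + 2 * h))" for y
  proof -
    obtain \<alpha> where \<alpha>: "\<And>z. z \<le> max X1 y \<Longrightarrow> R2 (z + (\<alpha> - real n * h)) \<le> R1 z"
      "\<And>z. z \<le> max X1 y \<Longrightarrow> R1 z \<le> R2 (z + (\<alpha> + h))"
      using key[of "max X1 y"] by auto
    \<comment> \<open>Both shifts are admissible at \<open>X1\<close>; comparing them there shows
      that they differ by at most \<open>(n + 1) * h\<close>.\<close>
    have "R2 (X1 + (\<alpha> - real n * h)) \<le> R2 (X1 + (a + h))" "R2 (X1 + (a - real n * h)) \<le> R2 (X1 + (\<alpha> + h))"
      using order_trans[OF \<alpha>(1)[of X1] a(2)[of X1]] order_trans[OF a(1)[of X1] \<alpha>(2)[of X1]] by auto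
    then have le: "\<alpha> - real n * h \<le> a + h" "a - real n * h \<le> \<alpha> + h"
      by (auto simp: strict_mono_less_eq[OF strict])
    have "R2 (y + (a - 2 * real n * h - h)) \<le> R2 (y + (\<alpha> - real n * h))"
      using le by (intro monoD[OF D2(2)]) (auto simp: algebra_simps)
    moreover have "R2 (y + (\<alpha> + h)) \<le> R2 (y + (a + real n * h + 2 * h))"
      using le by (intro monoD[OF D2(2)]) auto
    ultimately show ?thesis using \<alpha>(1)[of y] \<alpha>(2)[of y] by auto
  qed
  then show ?thesis using that by blast
qed

theorem steady_unique:
  assumes R1: "steady R1" "(R1 \<longlongrightarrow> rp) at_top" and R2: "steady R2" "(R2 \<longlongrightarrow> rp) at_top"
    and eq0: "R1 0 = R2 0" and less: "R2 0 < rp"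
  shows "R1 = R2"
proof -
  note D1 = steadyD[OF R1(1)] and D2 = steadyD[OF R2(1)]
  have lt2: "R2 x < rp" for x using steady_less_rp[OF R2(1) less] by simp
  have strict: "strict_mono R2" by (rule steady_strict_mono[OF R2 less])
  define S where "S = {A. \<forall>y. R1 y \<le> R2 (y + A)}"
  define S' where "S' = {B. \<forall>y. R2 (y + B) \<le> R1 y}"
  have cont: "continuous_on UNIV (\<lambda>A. R2 (y + A))" for y
    by (intro continuous_intros continuous_on_compose2[OF D2(1)]) auto
  have cl: "closed S" "closed S'"
    unfolding S_def S'_def by (intro closed_Collect_all closed_Collect_le continuous_intros cont)+
  have le: "B \<le> A" if "A \<in> S" "B \<in> S'" for A B
  proof -
    have "R2 (0 + B) \<le> R2 (0 + A)" using that unfolding S_def S'_def by (blast intro: order_trans)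
    then show ?thesis by (simp add: strict_mono_less_eq[OF strict])
  qed
  obtain A0 B0 where AB: "A0 \<in> S" "B0 \<in> S'"
  proof (rule steady_shift_bounds[OF R1 R2 eq0 less])
    fix A B assume "\<And>y. R1 y \<le> R2 (y + A)" "\<And>y. R2 (y + B) \<le> R1 y"
    then show ?thesis by (intro that[of A B]) (auto simp: S_def S'_def)
  qed
  have bdd: "bdd_below S" "bdd_above S'" using le[OF _ AB(2)] le[OF AB(1)] by (meson bdd_belowI, meson bdd_aboveI)
  define M m where "M = Inf S" and "m = Sup S'"
  \<comment> \<open>The extremal shifts are attained because both sets are closed and every element
    of \<open>S'\<close> lies below every element of \<open>S\<close>.\<close>
  have "M \<in> S" "m \<in> S'"
    using closed_contains_Inf[OF _ bdd(1) cl(1)] closed_contains_Sup[OF _ bdd(2) cl(2)] AB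
    unfolding M_def m_def by blast+
  then have M: "\<And>y. R1 y \<le> R2 (y + M)" and m: "\<And>y. R2 (y + m) \<le> R1 y" by (auto simp: S_def S'_def)
  have "m \<le> M" using le \<open>M \<in> S\<close> \<open>m \<in> S'\<close> .
  have "\<not> m < M"
  proof
    assume "m < M"
    define \<eta> where "\<eta> = (M - m) / 4"
    have \<eta>: "0 < \<eta>" using \<open>m < M\<close> by (simp add: \<eta>_def)
    obtain c s1 s2 where c: "0 < c" "0 < s1" "s1 < s2" and propagate:
      "\<And>R1 R2 N \<eta> x a. steady R1 \<Longrightarrow> steady R2 \<Longrightarrow> (\<And>y. R1 y \<le> R2 y) \<Longrightarrow> 0 < \<eta> \<Longrightarrow> 0 < N
        \<Longrightarrow> x + real N * s1 \<le> a \<Longrightarrow> a + \<eta> \<le> x + real N * s2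
        \<Longrightarrow> \<exists>y\<in>{a..a + \<eta>}. (c * \<eta> / real N) ^ N * (R2 y - R1 y) \<le> R2 x - R1 x"
      using steady_propagation by metis
    \<comment> \<open>The reach from any point of \<open>[X, X + h]\<close> must cover a window of
      length \<open>h\<close> displaced by either extremal shift, with room for \<eta>.\<close>
    obtain N where N: "2 * h + 2 * \<bar>M\<bar> + 2 * \<bar>m\<bar> + 3 * \<eta> < real N * (s2 - s1)"
      using ex_less_of_nat_mult[of "s2 - s1"] c by auto
    then have "0 < N" using \<eta> h_pos by (cases N) auto
    define K where "K = (c * \<eta> / real N) ^ N"
    have K: "0 < K" using c \<eta> \<open>0 < N\<close> by (simp add: K_def)
    define \<tau> where "\<tau> = h + real N * s1 + \<bar>M\<bar> + \<bar>m\<bar> + \<eta>"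
    \<comment> \<open>The point \<open>X - r\<close> lies to the left of every shifted contact
      point, since \<epsilon> is at most 1.\<close>
    define r where "r = \<bar>M\<bar> + \<bar>m\<bar> + 1"
    have "0 \<le> \<tau> + r" using h_pos c \<eta> by (simp add: \<tau>_def r_def)
    then obtain C where C: "0 < C" "\<And>R x. steady R \<Longrightarrow> rp - R x \<le> C * (rp - R (x + (\<tau> + r)))"
      using steady_harnack by metis
    \<comment> \<open>By the decay, \<gamma> is the least relative loss of deficit over a length
      \<open>h\<close>. The choice of \<omega> below makes the chained increments, after Harnack, at
      most half of that loss.\<close>
    define \<gamma> where "\<gamma> = 1 - 1 / \<kappa>"
    have \<gamma>: "0 < \<gamma>" using \<kappa> by (simp add: \<gamma>_def)
    define J where "J = h / \<eta> + 1"
    have J: "0 < J" using h_pos \<eta> by (simp add: J_def add_pos_pos)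
    define \<omega> where "\<omega> = K * \<gamma> / (4 * C * J)"
    have \<omega>: "0 < \<omega>" using K \<gamma> C J by (simp add: \<omega>_def)
    obtain \<delta> where \<delta>: "0 < \<delta>" and mod: "\<And>R x \<epsilon>. steady R \<Longrightarrow> 0 \<le> \<epsilon> \<Longrightarrow> \<epsilon> \<le> \<delta> \<Longrightarrow> R (x + \<epsilon>) - R x \<le> \<omega> * (rp - R x)"
      using steady_modulus[OF \<omega>] by blast
    define \<epsilon> where "\<epsilon> = min \<delta> 1"
    have \<epsilon>: "0 < \<epsilon>" "\<epsilon> \<le> \<delta>" "\<epsilon> \<le> 1" using \<delta> by (auto simp: \<epsilon>_def)
    have "M - \<epsilon> \<notin> S" using cInf_lower[OF _ bdd(1), of "M - \<epsilon>"] \<epsilon> by (auto simp: M_def)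
    then obtain ya where ya: "R2 (ya + (M - \<epsilon>)) < R1 ya" by (auto simp: S_def not_le)
    have "m + \<epsilon> \<notin> S'" using cSup_upper[OF _ bdd(2), of "m + \<epsilon>"] \<epsilon> by (auto simp: m_def)
    then obtain yb where yb: "R1 yb < R2 (yb + (m + \<epsilon>))" by (auto simp: S'_def not_le)
    obtain X0 where X0: "\<And>x n. X0 \<le> x \<Longrightarrow> \<kappa> ^ n * (rp - R2 (x + real n * h)) \<le> rp - R2 x"
      using steady_decay[OF R2] by blast
    define X where "X = max X0 (max ya yb)"
    \<comment> \<open>If the improved shift \<open>M - \<epsilon>\<close> were admissible on the
      whole window, the ordering would propagate left to \<open>ya\<close>, where it fails.\<close>
    have "\<exists>x\<ge>X. x \<le> X + h \<and> R2 (x + (M - \<epsilon>)) < R1 x"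
    proof (rule ccontr)
      assume no: "\<not> ?thesis"
      have "R1 ya \<le> R2 (ya + (M - \<epsilon>))"
        by (rule steady_order_back[OF R1(1) steady_shift[OF R2(1)], of X]) (use h_pos no in \<open>auto simp: X_def not_less\<close>)
      then show False using ya by simp
    qed
    then obtain x0 where x0: "X \<le> x0" "x0 \<le> X + h" "R2 (x0 + (M - \<epsilon>)) < R1 x0" by blast
    have "\<exists>x\<ge>X. x \<le> X + h \<and> R1 x < R2 (x + (m + \<epsilon>))"
    proof (rule ccontr)
      assume no: "\<not> ?thesis"
      have "R2 (yb + (m + \<epsilon>)) \<le> R1 yb"
        by (rule steady_order_back[OF steady_shift[OF R2(1)] R1(1), of X]) (use h_pos no in \<open>auto simp: X_def not_less\<close>)
      then show False using yb by simp
    qed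
    then obtain x1 where x1: "X \<le> x1" "x1 \<le> X + h" "R1 x1 < R2 (x1 + (m + \<epsilon>))" by blast
    define b where "b = X - r"
    \<comment> \<open>At \<open>x0\<close> the profile \<open>R1\<close> lies above
      \<open>R2\<close> shifted by \<open>M - \<epsilon>\<close>, so its gap to \<open>R2\<close>
      shifted by \<open>M\<close> is at most an increment of \<open>R2\<close> over length
      \<epsilon>.\<close>
    have d0: "R2 (x0 + M) - R1 x0 \<le> \<omega> * (rp - R2 b)"
    proof -
      have "R2 (x0 + M) - R2 (x0 + (M - \<epsilon>)) \<le> \<omega> * (rp - R2 (x0 + (M - \<epsilon>)))"
        using mod[OF R2(1), of \<epsilon> "x0 + (M - \<epsilon>)"] \<epsilon> by simp
      moreover have "R2 b \<le> R2 (x0 + (M - \<epsilon>))"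
        using x0 \<epsilon> by (intro monoD[OF D2(2)]) (auto simp: b_def r_def)
      then have "\<omega> * (rp - R2 (x0 + (M - \<epsilon>))) \<le> \<omega> * (rp - R2 b)" using \<omega> by simp
      ultimately show ?thesis using x0 by linarith
    qed
    have d1: "R1 x1 - R2 (x1 + m) \<le> \<omega> * (rp - R2 b)"
    proof -
      have "R2 (x1 + (m + \<epsilon>)) - R2 (x1 + m) \<le> \<omega> * (rp - R2 (x1 + m))"
        using mod[OF R2(1), of \<epsilon> "x1 + m"] \<epsilon> by (simp add: add.assoc)
      moreover have "R2 b \<le> R2 (x1 + m)"
        using x1 \<epsilon> by (intro monoD[OF D2(2)]) (auto simp: b_def r_def)
      then have "\<omega> * (rp - R2 (x1 + m)) \<le> \<omega> * (rp - R2 b)" using \<omega> by simp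
      ultimately show ?thesis using x1 by linarith
    qed
    define T where "T = X + \<tau>"
    have incr: "R2 (t + \<eta>) - R2 t \<le> 2 * \<omega> * (rp - R2 b) / K" if t: "T \<le> t" "t \<le> T + h" for t
    proof -
      have N': "2 * h + 2 * \<bar>M\<bar> + 2 * \<bar>m\<bar> + 3 * \<eta> + real N * s1 < real N * s2"
        using N by (simp add: algebra_simps)
      have "\<exists>y\<in>{t + \<eta> - M..t + \<eta> - M + \<eta>}. (c * \<eta> / real N) ^ N * (R2 (y + M) - R1 y) \<le> R2 (x0 + M) - R1 x0"
        using N' t x0 \<eta> \<open>0 < N\<close> unfolding T_def \<tau>_def
        by (intro propagate[OF R1(1) steady_shift[OF R2(1)] M]) linarith+
      then obtain y where y: "t + \<eta> - M \<le> y" "y \<le> t + \<eta> - M + \<eta>" "K * (R2 (y + M) - R1 y) \<le> R2 (x0 + M) - R1 x0"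
        by (auto simp: K_def)
      have "\<exists>y\<in>{t - m - \<eta>..t - m - \<eta> + \<eta>}. (c * \<eta> / real N) ^ N * (R1 y - R2 (y + m)) \<le> R1 x1 - R2 (x1 + m)"
        using N' t x1 \<eta> \<open>0 < N\<close> unfolding T_def \<tau>_def
        by (intro propagate[OF steady_shift[OF R2(1)] R1(1) m]) linarith+
      then obtain y' where y': "t - m - \<eta> \<le> y'" "y' \<le> t - m" "K * (R1 y' - R2 (y' + m)) \<le> R1 x1 - R2 (x1 + m)"
        by (auto simp: K_def)
      \<comment> \<open>The two contacts collide: \<open>y + M\<close> is at least
        \<open>t + \<eta>\<close> and \<open>y' + m\<close> at most \<open>t\<close>, yet
        \<open>y\<close> precedes \<open>y'\<close> because \<open>M - m = 4 * \<eta>\<close>.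
        Monotonicity of \<open>R1\<close> then traps the increment of \<open>R2\<close> between two
        small gaps.\<close>
      have "y \<le> y'" using y y' by (simp add: \<eta>_def field_simps)
      then have "R1 y \<le> R1 y'" by (rule monoD[OF D1(2)])
      moreover have "R2 (t + \<eta>) \<le> R2 (y + M)" "R2 (y' + m) \<le> R2 t" using y y' by (auto intro!: monoD[OF D2(2)])
      ultimately have "R2 (t + \<eta>) - R2 t \<le> (R2 (y + M) - R1 y) + (R1 y' - R2 (y' + m))" by linarith
      then have "K * (R2 (t + \<eta>) - R2 t) \<le> K * ((R2 (y + M) - R1 y) + (R1 y' - R2 (y' + m)))"
        using K by (intro mult_left_mono) auto
      also have "\<dots> \<le> 2 * \<omega> * (rp - R2 b)" using y(3) y'(3) d0 d1 by (simp add: distrib_left)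
      finally show ?thesis using K by (simp add: field_simps)
    qed
    have "R2 (T + h) - R2 T \<le> J * (2 * \<omega> * (rp - R2 b) / K)"
      unfolding J_def using \<eta> h_pos \<omega> K lt2[of b] incr by (intro increment_chain D2(2)) auto
    also have "\<dots> = \<gamma> / (2 * C) * (rp - R2 b)" using K C(1) J by (simp add: \<omega>_def divide_simps)
    also have "\<dots> \<le> \<gamma> / (2 * C) * (C * (rp - R2 T))"
      using C(2)[OF R2(1), of b] \<gamma> C(1) by (intro mult_left_mono) (auto simp: T_def b_def)
    also have "\<dots> = \<gamma> / 2 * (rp - R2 T)" using C(1) by simp
    finally have "R2 (T + h) - R2 T \<le> \<gamma> / 2 * (rp - R2 T)" .
    \<comment> \<open>The decay demands an increase of at least \<gamma> times the deficit over this
      window, twice what the chain permits.\<close>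
    moreover have "X0 \<le> T" using h_pos c \<eta> by (simp add: T_def X_def \<tau>_def add_increasing2)
    then have "\<kappa> * (rp - R2 (T + h)) \<le> rp - R2 T" using X0[of T 1] by simp
    then have "rp - R2 (T + h) \<le> (rp - R2 T) / \<kappa>" using \<kappa> by (simp add: field_simps)
    then have "\<gamma> * (rp - R2 T) \<le> R2 (T + h) - R2 T" by (simp add: \<gamma>_def algebra_simps diff_divide_distrib)
    moreover have "0 < \<gamma> * (rp - R2 T)" using \<gamma> lt2 by simp
    ultimately show False by simp
  qed
  then have "m = M" using \<open>m \<le> M\<close> by simp
  then have eq: "R1 y = R2 (y + M)" for y using M[of y] m[of y] by simp
  then have "R2 M = R2 0" using eq[of 0] eq0 by simp
  then have "M = 0" using strict_mono_eq[OF strict] by simp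
  then show ?thesis using eq by (intro ext) simp
qed

end

section \<open>The average over partitions and its limit at infinity\<close>

context nonlocal_traffic
begin

lemma has_integral_wavg:
  assumes "continuous_on UNIV g" "x + h \<le> b"
  shows "((\<lambda>y. g y * w (y - x)) has_integral wavg g x) {x..b}"
proof -
  have "((\<lambda>s. g (x + s) * w s) has_integral wavg g x) {0..h}"
    unfolding wavg_def by (intro integrable_integral wavg_integrable assms(1))
  from has_integral_shift_real_ivl[OF this, of "-x"]
  have "((\<lambda>y. g y * w (y - x)) has_integral wavg g x) {x..x + h}" by (simp add: add.commute)
  then show ?thesis
    by (rule has_integral_on_superset) (use assms w_zero in auto)
qed

lemma wavg_integrand_integrable:
  assumes "continuous_on UNIV g"
  shows "(\<lambda>y. g y * w (y - x)) integrable_on {a..b}"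
proof -
  have "((\<lambda>s. g (x + s) * w s) has_integral wavg g x) {0..h}"
    unfolding wavg_def by (intro integrable_integral wavg_integrable assms(1))
  from has_integral_shift_real_ivl[OF this, of "-x"]
  have "((\<lambda>y. g y * w (y - x)) has_integral wavg g x) {x..x + h}" by (simp add: add.commute)
  then have "((\<lambda>y. g y * w (y - x)) has_integral wavg g x) UNIV"
    by (rule has_integral_on_superset) (use w_zero in auto)
  then show ?thesis by (intro integrable_on_subinterval[of _ UNIV]) auto
qed

lemma wavg_partition:
  assumes "continuous_on UNIV g" and z: "z 0 = x" "\<And>k. z k \<le> z (Suc k)" "x + h \<le> z N"
  shows "(\<Sum>k<N. integral {z k..z (Suc k)} (\<lambda>y. g y * w (y - x))) = wavg g x"
proof -
  have le: "x \<le> z n" for n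
    using lift_Suc_mono_le[of z 0 n] z by simp
  have "(\<Sum>k<n. integral {z k..z (Suc k)} (\<lambda>y. g y * w (y - x))) = integral {x..z n} (\<lambda>y. g y * w (y - x))" for n
  proof (induction n)
    case (Suc n)
    then show ?case
      using Henstock_Kurzweil_Integration.integral_combine[OF le[of n] z(2)[of n] wavg_integrand_integrable[OF assms(1)]]
      by simp
  qed (use z in simp)
  then show ?thesis
    using integral_unique[OF has_integral_wavg[OF assms(1), of x "z N"]] z by simp
qed

text \<open>The average is squeezed between \<open>v (R (x + h))\<close> and
  \<open>v (R x)\<close>.\<close>

lemma wavg_front_tendsto:
  assumes R: "continuous_on UNIV R" "mono R" "\<And>x. 0 \<le> R x" "\<And>x. R x \<le> 1" and lim: "(R \<longlongrightarrow> b) at_top"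
  shows "((\<lambda>x. v (R (x + a))) \<longlongrightarrow> v b) at_top" "(wavg (\<lambda>y. v (R y)) \<longlongrightarrow> v b) at_top"
proof -
  have b: "b \<in> {0..1}"
    using tendsto_lowerbound[OF lim always_eventually, of 0] tendsto_upperbound[OF lim always_eventually, of 1] R by auto
  show *: "((\<lambda>x. v (R (x + a))) \<longlongrightarrow> v b) at_top" for a
  proof (rule continuous_on_tendsto_compose[OF v_cont _ b])
    have "filterlim (\<lambda>x. a + x) at_top at_top"
      by (intro filterlim_tendsto_add_at_top[OF tendsto_const] filterlim_ident)
    then show "((\<lambda>x. R (x + a)) \<longlongrightarrow> b) at_top"
      using filterlim_compose[OF lim] by (simp add: add.commute)
  qed (use R in auto)
  have vc: "continuous_on UNIV (\<lambda>y. v (R y))" using R by (intro v_comp_cont) auto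
  have va: "antimono (\<lambda>y. v (R y))" using R(2-4) v_antimono by (auto simp: antimono_def mono_def)
  show "(wavg (\<lambda>y. v (R y)) \<longlongrightarrow> v b) at_top"
    by (rule tendsto_sandwich[OF _ _ *[of h] *[of 0]]) (use wavg_bounds[OF vc va] in auto)
qed

lemma steady_constant:
  assumes R: "continuous_on UNIV R" "mono R" "\<And>x. 0 \<le> R x" "\<And>x. R x \<le> 1" and lim: "(R \<longlongrightarrow> b) at_top"
    and const: "\<And>x. R x * wavg (\<lambda>y. v (R y)) x = c"
  shows "c = b * v b"
proof -
  have "((\<lambda>x. R x * wavg (\<lambda>y. v (R y)) x) \<longlongrightarrow> b * v b) at_top"
    by (intro tendsto_mult lim wavg_front_tendsto(2)[OF R lim])
  then show ?thesis unfolding const by (simp add: tendsto_const_iff)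
qed

end

section \<open>Discrete profiles\<close>

text \<open>The lower bound \<open>r\<close>, later \<rho>minus, limits the distance to the leader
  to \<open>l / r\<close>; this is the length scale of all discretisation errors.\<close>

locale discrete_profile = nonlocal_traffic +
  fixes P :: "real \<Rightarrow> real" and l r :: real
  assumes l_pos: "0 < l" and r_pos: "0 < r"
    and P_cont: "continuous_on UNIV P" and P_mono: "mono P"
    and P_ge: "\<And>x. r \<le> P x" and P_le: "\<And>x. P x \<le> rp"
    and P_lim: "(P \<longlongrightarrow> rp) at_top"
    and P_deriv: "\<And>x. (P has_real_derivative
        - ((P x)\<^sup>2 / (l * avg_velocity w v l P x))
          * (avg_velocity w v l P (leader l P x) - avg_velocity w v l P x)) (at x)"
begin

abbreviation B :: "real \<Rightarrow> real" where "B \<equiv> avg_velocity w v l P"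
abbreviation g :: "real \<Rightarrow> real" where "g \<equiv> \<lambda>y. v (P y)"
abbreviation z :: "nat \<Rightarrow> real \<Rightarrow> real" where "z k \<equiv> leader l P ^^ k"

lemma P_pos: "0 < P x"
  using P_ge[of x] r_pos by linarith

lemma P_unit: "0 \<le> P x" "P x \<le> 1"
  using P_pos[of x] P_le[of x] rp_less by auto

lemma leader_bounds: "x + l \<le> leader l P x" "leader l P x \<le> x + l / r"
proof -
  have "l / 1 \<le> l / P x" using l_pos P_pos[of x] P_unit(2)[of x] by (intro divide_left_mono) auto
  then show "x + l \<le> leader l P x" by (simp add: leader_def)
  show "leader l P x \<le> x + l / r"
    using l_pos P_ge[of x] r_pos P_pos[of x] by (auto simp: leader_def intro!: divide_left_mono)
qed

lemma z_bounds: "x + real k * l \<le> z k x" "z k x \<le> x + real k * (l / r)"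
proof (induction k)
  case (Suc k)
  { case 1 then show ?case using Suc(1) leader_bounds(1)[of "z k x"] by (simp add: algebra_simps) }
  { case 2 then show ?case using Suc(2) leader_bounds(2)[of "z k x"] by (simp add: algebra_simps) }
qed simp_all

lemma z_Suc: "z k x \<le> z (Suc k) x" "z (Suc k) x \<le> z k x + l / r"
  using leader_bounds[of "z k x"] l_pos by auto

lemma g_cont: "continuous_on UNIV g"
  using P_cont P_unit by (intro v_comp_cont) auto

lemma g_antimono: "antimono g"
  using P_mono P_unit v_antimono by (auto simp: antimono_def mono_def)

lemma w_shift_integrable: "(\<lambda>y. w (y - x)) integrable_on {a..b}"
  using wavg_integrand_integrable[of "\<lambda>_. 1" x a b] by simp

lemma avg_velocity_sum:
  assumes "h < real N * l"
  shows "B x = (\<Sum>k<N. integral {z k x..z (Suc k) x} (\<lambda>y. w (y - x)) * g (z k x))"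
  unfolding avg_velocity_def
proof (rule suminf_finite)
  fix k assume "k \<notin> {..<N}"
  then have "real N * l \<le> real k * l" using l_pos by (intro mult_right_mono) auto
  then have "x + h < z k x" using z_bounds(1)[of x k] assms by linarith
  then have "integral {z k x..z (Suc k) x} (\<lambda>y. w (y - x)) = integral {z k x..z (Suc k) x} (\<lambda>_. 0)"
    by (intro integral_cong w_zero) auto
  then show "integral {z k x..z (Suc k) x} (\<lambda>y. w (y - x)) * g (z k x) = 0" by simp
qed simp

text \<open>\<open>B\<close> samples the decreasing function \<open>g\<close> at the left end of
  each cell, hence overestimates its average. A cell has length at most \<open>l / r\<close>, so the
  sampled value is at most \<open>g (y - l / r)\<close>.\<close>

lemma avg_velocity_bounds: "wavg g x \<le> B x" "B x \<le> wavg g (x - l / r)"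
proof -
  obtain N where N: "h < real N * l" using ex_less_of_nat_mult[OF l_pos] by blast
  have zN: "x + h \<le> z N x" using z_bounds(1)[of x N] N by linarith
  have part: "(\<Sum>k<N. integral {z k x..z (Suc k) x} (\<lambda>y. f y * w (y - x))) = wavg f x"
    if "continuous_on UNIV f" for f
    by (intro wavg_partition[of f "\<lambda>k. z k x"] that z_Suc zN) simp
  have const: "integral {z k x..z (Suc k) x} (\<lambda>y. w (y - x)) * g (z k x)
      = integral {z k x..z (Suc k) x} (\<lambda>y. g (z k x) * w (y - x))" for k
    by (simp add: mult.commute)
  have gc: "continuous_on UNIV (\<lambda>y. g (y - l / r))"
    by (intro continuous_intros continuous_on_compose2[OF g_cont]) auto
  have "wavg g x = (\<Sum>k<N. integral {z k x..z (Suc k) x} (\<lambda>y. g y * w (y - x)))"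
    by (rule part[OF g_cont, symmetric])
  also have "\<dots> \<le> (\<Sum>k<N. integral {z k x..z (Suc k) x} (\<lambda>y. g (z k x) * w (y - x)))"
    by (intro sum_mono integral_le wavg_integrand_integrable g_cont continuous_on_const mult_right_mono
        w_nonneg antimonoD[OF g_antimono]) auto
  also have "\<dots> = B x" unfolding avg_velocity_sum[OF N] const ..
  finally show "wavg g x \<le> B x" .
  have "B x = (\<Sum>k<N. integral {z k x..z (Suc k) x} (\<lambda>y. g (z k x) * w (y - x)))"
    unfolding avg_velocity_sum[OF N] const ..
  also have "\<dots> \<le> (\<Sum>k<N. integral {z k x..z (Suc k) x} (\<lambda>y. g (y - l / r) * w (y - x)))"
  proof (intro sum_mono integral_le wavg_integrand_integrable gc continuous_on_const mult_right_mono
        w_nonneg antimonoD[OF g_antimono])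
    fix k y assume "y \<in> {z k x..z (Suc k) x}"
    then show "y - l / r \<le> z k x" using z_Suc(2)[where k = k and x = x] by auto
  qed
  also have "\<dots> = wavg (\<lambda>y. g (y - l / r)) x" by (rule part[OF gc])
  also have "\<dots> = wavg g (x - l / r)" using wavg_shift[of g "- (l / r)" x] by simp
  finally show "B x \<le> wavg g (x - l / r)" .
qed

lemma avg_velocity_pos: "0 < B x"
proof -
  have "wavg (\<lambda>_. v rp) x \<le> wavg g x"
    using P_unit P_le rp_less by (intro wavg_mono g_cont continuous_on_const v_antimono) auto
  then show ?thesis using avg_velocity_bounds(1)[of x] v_rp_pos by simp
qed

lemma z_cont: "continuous_on UNIV (z k)"
proof (induction k)
  case (Suc k)
  have "P y \<noteq> 0" for y using P_pos[of y] by simp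
  then have "continuous_on UNIV (\<lambda>x. leader l P x)"
    unfolding leader_def by (intro continuous_intros P_cont) auto
  then have "continuous_on UNIV (\<lambda>x. leader l P (z k x))"
    by (rule continuous_on_compose2[OF _ Suc]) auto
  then show ?case by simp
qed (simp add: id_def)

text \<open>Since \<open>w\<close> may jump at 0 and \<open>h\<close>, continuity is read off from
  its primitive \<open>W\<close>. One truncation index \<open>N\<close> serves all \<open>x\<close>,
  so \<open>B\<close> is a finite sum of continuous functions.\<close>

lemma avg_velocity_cont: "continuous_on UNIV B"
proof -
  obtain N where N: "h < real N * l" using ex_less_of_nat_mult[OF l_pos] by blast
  define W where "W t = integral {0..t} w" for t
  define T where "T = real N * (l / r)"
  have wi: "w integrable_on {a..b}" for a b using w_shift_integrable[of 0] by simp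
  have Wc: "continuous_on {0..T} W" unfolding W_def by (intro indefinite_integral_continuous_1 wi)
  have z_range: "z k x - x \<in> {0..T}" if "k \<le> N" for k x
  proof -
    have "real k * (l / r) \<le> T" using that l_pos r_pos by (auto simp: T_def intro!: mult_right_mono divide_right_mono)
    moreover have "0 \<le> real k * l" using l_pos by simp
    ultimately show ?thesis using z_bounds[where k = k and x = x] by (simp del: times_divide_eq_right)
  qed
  have int: "integral {z k x..z (Suc k) x} (\<lambda>y. w (y - x)) = W (z (Suc k) x - x) - W (z k x - x)"
    if "k < N" for k x
  proof -
    have "integral {z k x..z (Suc k) x} (\<lambda>y. w (y - x)) = integral {z k x - x..z (Suc k) x - x} w"
      using integral_shift_real_ivl[of "z k x - x" "-x" "z (Suc k) x - x" w] by simp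
    moreover have "integral {0..z k x - x} w + integral {z k x - x..z (Suc k) x - x} w = integral {0..z (Suc k) x - x} w"
      using z_range[of k x] that z_Suc(1)[where k = k and x = x]
      by (intro Henstock_Kurzweil_Integration.integral_combine wi) auto
    ultimately show ?thesis by (simp add: W_def)
  qed
  have "continuous_on UNIV (\<lambda>x. \<Sum>k<N. (W (z (Suc k) x - x) - W (z k x - x)) * g (z k x))"
  proof (intro continuous_on_sum continuous_on_mult continuous_on_diff)
    fix k assume k: "k \<in> {..<N}"
    show "continuous_on UNIV (\<lambda>x. W (z (Suc k) x - x))" "continuous_on UNIV (\<lambda>x. W (z k x - x))"
      using z_range[of "Suc k"] z_range[of k] k
      by (auto intro!: continuous_on_compose2[OF Wc] continuous_on_diff z_cont continuous_on_id simp del: funpow.simps)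
    show "continuous_on UNIV (\<lambda>x. g (z k x))" by (rule continuous_on_compose2[OF g_cont z_cont]) auto
  qed
  moreover have "B = (\<lambda>x. \<Sum>k<N. (W (z (Suc k) x - x) - W (z k x - x)) * g (z k x))"
    unfolding avg_velocity_sum[OF N] by (intro ext sum.cong refl) (simp only: int lessThan_iff)
  ultimately show ?thesis by (simp only:)
qed

text \<open>The profile equation says \<open>leader' = B \<circ> leader / B\<close>, so the time \<open>\<integral> 1 / B\<close> that a car needs
  to reach the position of its leader does not depend on the car.\<close>

lemma travel_time_constant: "\<exists>c. \<forall>x. \<exists>\<xi>. x \<le> \<xi> \<and> \<xi> \<le> x + l / r \<and> P x * B \<xi> = c"
proof -
  have "isCont (\<lambda>y. 1 / B y) x" for x
    using avg_velocity_cont avg_velocity_pos[of x]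
    by (intro continuous_intros) (auto simp: continuous_on_eq_continuous_at)
  then have "\<exists>G. \<forall>x. (G has_vector_derivative 1 / B x) (at x)"
    using einterval_antiderivative[of "-\<infinity>" "\<infinity>" "\<lambda>y. 1 / B y"] by auto
  then obtain G where G: "(G has_real_derivative 1 / B x) (at x)" for x
    by (auto simp: has_real_derivative_iff_has_vector_derivative)
  \<comment> \<open>The derivative of \<open>x + l / P x\<close> is \<open>1 - l * P' / P^2\<close>,
    and the profile equation replaces \<open>P'\<close>.\<close>
  have L: "(leader l P has_real_derivative B (leader l P x) / B x) (at x)" for x
  proof -
    have "((\<lambda>x. x + l / P x) has_real_derivative B (leader l P x) / B x) (at x)"
      using avg_velocity_pos[of x] P_pos[of x] l_pos
      by (auto intro!: derivative_eq_intros P_deriv simp: field_simps power2_eq_square)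
    then show ?thesis by (simp add: leader_def[abs_def])
  qed
  have "((\<lambda>x. G (leader l P x) - G x) has_real_derivative 0) (at x)" for x
  proof -
    have "((\<lambda>x. G (leader l P x) - G x) has_real_derivative
        1 / B (leader l P x) * (B (leader l P x) / B x) - 1 / B x) (at x)"
      by (intro DERIV_diff DERIV_chain2[OF G L] G)
    then show ?thesis using avg_velocity_pos[of "leader l P x"] by simp
  qed
  then have const: "G (leader l P x) - G x = G (leader l P 0) - G 0" for x
    using DERIV_isconst_all[of "\<lambda>x. G (leader l P x) - G x" x 0] by blast
  define \<tau> where "\<tau> = G (leader l P 0) - G 0"
  have "\<exists>\<xi>. x \<le> \<xi> \<and> \<xi> \<le> x + l / r \<and> P x * B \<xi> = l / \<tau>" for x
  proof -
    have "x < leader l P x" using leader_bounds(1)[of x] l_pos by linarith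
    then obtain \<xi> where \<xi>: "x < \<xi>" "\<xi> < leader l P x" "G (leader l P x) - G x = (leader l P x - x) * (1 / B \<xi>)"
      using MVT2[of x "leader l P x" G "\<lambda>y. 1 / B y"] G by blast
    then have "\<tau> = l / (P x * B \<xi>)" using const[of x] by (simp add: \<tau>_def leader_def)
    then have "P x * B \<xi> = l / \<tau>" using P_pos[of x] avg_velocity_pos[of \<xi>] l_pos by simp
    then show ?thesis using \<xi> leader_bounds(2)[of x] by (intro exI[of _ \<xi>]) auto
  qed
  then show ?thesis by blast
qed

text \<open>Averages decrease in \<open>x\<close>, so replacing \<open>B \<xi>\<close> by averages
  at \<open>x + l / r\<close> and \<open>x - l / r\<close> gives one-sided bounds. Letting
  \<open>x\<close> tend to infinity identifies the constant as the flux at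
  \<open>rp\<close>.\<close>

lemma profile_squeeze:
  "P x * wavg g (x + l / r) \<le> rp * v rp" "rp * v rp \<le> P x * wavg g (x - l / r)"
proof -
  obtain c where c: "\<And>x. \<exists>\<xi>. x \<le> \<xi> \<and> \<xi> \<le> x + l / r \<and> P x * B \<xi> = c" using travel_time_constant by blast
  have sq: "P x * wavg g (x + l / r) \<le> c" "c \<le> P x * wavg g (x - l / r)" for x
  proof -
    obtain \<xi> where \<xi>: "x \<le> \<xi>" "\<xi> \<le> x + l / r" "P x * B \<xi> = c" using c by blast
    have "wavg g (x + l / r) \<le> wavg g \<xi>" "wavg g (\<xi> - l / r) \<le> wavg g (x - l / r)"
      using \<xi> by (intro wavg_antimono g_cont g_antimono; simp)+
    then have "wavg g (x + l / r) \<le> B \<xi>" "B \<xi> \<le> wavg g (x - l / r)"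
      using avg_velocity_bounds[of \<xi>] by linarith+
    then show "P x * wavg g (x + l / r) \<le> c" "c \<le> P x * wavg g (x - l / r)"
      using P_pos[of x] unfolding \<xi>(3)[symmetric] by (simp_all add: mult_left_mono)
  qed
  have lim: "((\<lambda>x. P x * wavg g (x + a)) \<longlongrightarrow> rp * v rp) at_top" for a
  proof -
    have "filterlim (\<lambda>x. a + x) at_top at_top"
      by (intro filterlim_tendsto_add_at_top[OF tendsto_const] filterlim_ident)
    then have "((\<lambda>x. wavg g (x + a)) \<longlongrightarrow> v rp) at_top"
      using filterlim_compose[OF wavg_front_tendsto(2)[OF P_cont P_mono P_unit P_lim]] by (simp add: add.commute)
    then show ?thesis by (intro tendsto_mult P_lim)
  qed
  have "rp * v rp \<le> c" by (rule tendsto_upperbound[OF lim[of "l / r"]]) (use sq in auto)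
  moreover have "c \<le> rp * v rp" by (rule tendsto_lowerbound[OF lim[of "- (l / r)"]]) (use sq in auto)
  ultimately show "P x * wavg g (x + l / r) \<le> rp * v rp" "rp * v rp \<le> P x * wavg g (x - l / r)"
    using sq[of x] by simp_all
qed

end

context nonlocal_traffic
begin

section \<open>Compactness\<close>

text \<open>The stationary equation is relaxed to two inequalities with averages displaced by
  \<open>d\<close>; for \<open>d = 0\<close> this is \<open>steady\<close>.\<close>

definition near_steady :: "real \<Rightarrow> (real \<Rightarrow> real) \<Rightarrow> bool" where
  "near_steady d R \<longleftrightarrow> continuous_on UNIV R \<and> mono R \<and> (\<forall>x. 0 \<le> R x \<and> R x \<le> rp) \<and>
     (\<forall>x. R x * wavg (\<lambda>y. v (R y)) (x + d) \<le> rp * v rp \<and> rp * v rp \<le> R x * wavg (\<lambda>y. v (R y)) (x - d))"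

lemma near_steadyD:
  assumes "near_steady d R"
  shows "continuous_on UNIV R" "mono R" "0 \<le> R x" "R x \<le> rp" "R x \<le> 1"
    "R x * wavg (\<lambda>y. v (R y)) (x + d) \<le> rp * v rp" "rp * v rp \<le> R x * wavg (\<lambda>y. v (R y)) (x - d)"
    "continuous_on UNIV (\<lambda>y. v (R y))" "antimono (\<lambda>y. v (R y))" "v rp \<le> wavg (\<lambda>y. v (R y)) x"
proof -
  show R: "continuous_on UNIV R" "mono R" "0 \<le> R x" "R x \<le> rp" "R x \<le> 1"
    "R x * wavg (\<lambda>y. v (R y)) (x + d) \<le> rp * v rp" "rp * v rp \<le> R x * wavg (\<lambda>y. v (R y)) (x - d)" for x
    using assms rp_less by (auto simp: near_steady_def intro: order_trans[of "R x" rp 1])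
  show c: "continuous_on UNIV (\<lambda>y. v (R y))" using R by (intro v_comp_cont) auto
  show "antimono (\<lambda>y. v (R y))" using R(2,3,5) v_antimono by (auto simp: antimono_def mono_def)
  show "v rp \<le> wavg (\<lambda>y. v (R y)) x"
    using wavg_mono[of "\<lambda>_. v rp" "\<lambda>y. v (R y)" x] c R(3,4) rp_less v_antimono by auto
qed

text \<open>The inequalities bound \<open>R x\<close> above and \<open>R y\<close> below by
  reciprocals of averages taken at distance \<open>x - y + 2 * d\<close>. Hence oscillations are
  small only when \<open>d\<close> is small too.\<close>

lemma near_steady_equicontinuous:
  assumes "0 < \<eta>"
  obtains \<delta> where "0 < \<delta>"
    "\<And>R d x y. near_steady d R \<Longrightarrow> 0 \<le> d \<Longrightarrow> y \<le> x \<Longrightarrow> x - y + 2 * d \<le> \<delta> \<Longrightarrow> R x - R y \<le> \<eta>"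
proof -
  define \<eta>' where "\<eta>' = \<eta> * v rp / rp"
  have \<eta>': "0 < \<eta>'" using assms rp_pos v_rp_pos by (simp add: \<eta>'_def)
  then obtain \<delta> where \<delta>: "0 < \<delta>" and mod:
    "\<And>(g :: real \<Rightarrow> real) x \<epsilon>. continuous_on UNIV g \<Longrightarrow> antimono g \<Longrightarrow> (\<And>y. 0 \<le> g y) \<Longrightarrow> 0 \<le> \<epsilon> \<Longrightarrow> \<epsilon> \<le> \<delta>
      \<Longrightarrow> wavg g x - wavg g (x + \<epsilon>) \<le> \<eta>' * g x"
    using wavg_modulus by metis
  show ?thesis
  proof (rule that[OF \<delta>])
    fix R d x y assume R: "near_steady d R" and d: "0 \<le> d" "y \<le> x" "x - y + 2 * d \<le> \<delta>"
    note RD = near_steadyD[OF R]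
    let ?g = "\<lambda>y. v (R y)"
    let ?A = "wavg ?g (y - d)" and ?B = "wavg ?g (x + d)"
    have g: "0 \<le> ?g z" "?g z \<le> 1" for z using RD(3,5) v_bounds by auto
    have "?A - ?B \<le> \<eta>' * ?g (y - d)"
      using mod[OF RD(8,9) g(1), of "x - y + 2 * d" "y - d"] d by (simp add: add.commute)
    also have "\<dots> \<le> \<eta>'" using g \<eta>' by (simp add: mult_left_le)
    finally have AB: "?A - ?B \<le> \<eta>'" .
    have pos: "v rp \<le> ?A" "v rp \<le> ?B" "0 < ?A" "0 < ?B"
      using RD(10)[of "y - d"] RD(10)[of "x + d"] v_rp_pos by auto
    have "R x \<le> rp * v rp / ?B" "rp * v rp / ?A \<le> R y"
      using RD(6)[of x] RD(7)[of y] pos by (simp_all add: pos_le_divide_eq pos_divide_le_eq)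
    then have "R x - R y \<le> rp * v rp / ?B - rp * v rp / ?A" by linarith
    also have "\<dots> = rp * v rp * (?A - ?B) / (?A * ?B)" using pos(3,4) by (simp add: field_simps)
    also have "\<dots> \<le> rp * v rp * \<eta>' / (?A * ?B)"
      using AB pos rp_pos v_rp_pos by (intro divide_right_mono mult_left_mono) auto
    also have "\<dots> \<le> rp * v rp * \<eta>' / (v rp * v rp)"
      using \<eta>' pos rp_pos v_rp_pos by (intro divide_left_mono mult_mono mult_nonneg_nonneg mult_pos_pos) auto
    also have "\<dots> = \<eta>" using rp_pos v_rp_pos by (simp add: \<eta>'_def)
    finally show "R x - R y \<le> \<eta>" .
  qed
qed

lemma near_steady_compact:
  assumes R: "\<And>n. near_steady (d n) (R n)" and d: "\<And>n. 0 \<le> d n" "d \<longlonglongrightarrow> 0"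
  shows "\<exists>s F. strict_mono (s :: nat \<Rightarrow> nat) \<and> steady F \<and> (\<forall>x. (\<lambda>n. R (s n) x) \<longlonglongrightarrow> F x)"
proof -
  note RD = near_steadyD[OF R]
  have "continuous (at_right x) (R n)" for n x
    using RD(1)[of n] by (simp add: continuous_on_eq_continuous_at continuous_at_imp_continuous_at_within)
  moreover have "\<bar>R n x\<bar> \<le> rp" for n x using RD(3)[of n x] RD(4)[of n x] by simp
  ultimately obtain s F where s: "strict_mono (s :: nat \<Rightarrow> nat)" and F: "mono F"
    and conv: "\<And>x. isCont F x \<Longrightarrow> (\<lambda>n. R (s n) x) \<longlonglongrightarrow> F x"
    using Helly_selection[of R rp] RD(2) by blast
  define e where "e n = d (s n)" for n
  have e: "0 \<le> e n" "e \<longlonglongrightarrow> 0" "near_steady (e n) (R (s n))" for n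
    using d R LIMSEQ_subseq_LIMSEQ[OF d(2) s] by (auto simp: e_def[abs_def] comp_def)
  have cont_pt: "\<exists>c\<in>{a<..<b}. isCont F c" if "a < b" for a b
  proof (rule ccontr)
    assume "\<not> ?thesis"
    then have "{a<..<b} \<subseteq> {a. \<not> isCont F a}" by auto
    then show False
      using mono_ctble_discont[OF F] countable_subset uncountable_open_interval that by blast
  qed
  \<comment> \<open>Helly yields convergence only at continuity points of \<open>F\<close>, so
    \<open>x\<close> and \<open>y\<close> are enclosed between two such points before passing to the
    limit.\<close>
  have F_mod: "\<exists>\<delta>>0. \<forall>x y. y \<le> x \<and> x - y < \<delta> \<longrightarrow> F x - F y \<le> \<eta>" if \<eta>: "0 < \<eta>" for \<eta>
  proof -
    obtain \<delta> where \<delta>: "0 < \<delta>" "\<And>R d x y. near_steady d R \<Longrightarrow> 0 \<le> d \<Longrightarrow> y \<le> x \<Longrightarrow> x - y + 2 * d \<le> \<delta> \<Longrightarrow> R x - R y \<le> \<eta>"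
      using near_steady_equicontinuous[OF \<eta>] by blast
    have "F x - F y \<le> \<eta>" if xy: "y \<le> x" "x - y < \<delta> / 4" for x y
    proof -
      obtain a where a: "y - \<delta> / 4 < a" "a < y" "isCont F a" using cont_pt[of "y - \<delta> / 4" y] \<delta>(1) by auto
      obtain b where b: "x < b" "b < x + \<delta> / 4" "isCont F b" using cont_pt[of x "x + \<delta> / 4"] \<delta>(1) by auto
      have "\<forall>\<^sub>F n in sequentially. e n < \<delta> / 8" by (rule order_tendstoD(2)[OF e(2)]) (use \<delta>(1) in simp)
      then have "\<forall>\<^sub>F n in sequentially. R (s n) b - R (s n) a \<le> \<eta>"
      proof (rule eventually_mono)
        fix n assume "e n < \<delta> / 8"
        then show "R (s n) b - R (s n) a \<le> \<eta>" using xy a b e(1) by (intro \<delta>(2)[OF e(3)[of n]]) auto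
      qed
      then have "F b - F a \<le> \<eta>"
        by (intro tendsto_upperbound[OF tendsto_diff[OF conv[OF b(3)] conv[OF a(3)]]]) auto
      moreover have "F x \<le> F b" "F a \<le> F y" using a b by (auto intro!: monoD[OF F])
      ultimately show ?thesis by linarith
    qed
    then show ?thesis using \<delta>(1) by (intro exI[of _ "\<delta> / 4"]) auto
  qed
  have F_cont: "isCont F x" for x
    unfolding continuous_at_eps_delta
  proof (intro allI impI)
    fix \<eta> :: real assume "0 < \<eta>"
    then obtain \<delta> where \<delta>: "0 < \<delta>" "\<And>x y. y \<le> x \<Longrightarrow> x - y < \<delta> \<Longrightarrow> F x - F y \<le> \<eta> / 2"
      using F_mod[of "\<eta> / 2"] by auto
    have "dist (F y) (F x) < \<eta>" if "dist y x < \<delta>" for y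
      using that \<delta>(2)[of x y] \<delta>(2)[of y x] monoD[OF F, of x y] monoD[OF F, of y x] \<open>0 < \<eta>\<close>
      by (cases "x \<le> y") (auto simp: dist_real_def)
    then show "\<exists>\<delta>>0. \<forall>y. dist y x < \<delta> \<longrightarrow> dist (F y) (F x) < \<eta>" using \<delta>(1) by blast
  qed
  note lim = conv[OF F_cont]
  have F_bounds: "0 \<le> F x" "F x \<le> rp" for x
    using tendsto_lowerbound[OF lim[of x] always_eventually, of 0] tendsto_upperbound[OF lim[of x] always_eventually, of rp]
      RD(3,4) by auto
  \<comment> \<open>The relaxed equation evaluates averages at moving points, so convergence is
    needed along arguments that tend to \<open>x\<close>.\<close>
  have lim_shift: "(\<lambda>n. R (s n) (x + a n)) \<longlonglongrightarrow> F x" if a: "a \<longlonglongrightarrow> 0" for x a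
  proof (rule Lim_transform2[OF lim[of x]])
    show "(\<lambda>n. R (s n) x - R (s n) (x + a n)) \<longlonglongrightarrow> 0"
    proof (rule LIMSEQ_I)
      fix \<eta> :: real assume "0 < \<eta>"
      then obtain \<delta> where \<delta>: "0 < \<delta>" "\<And>R d x y. near_steady d R \<Longrightarrow> 0 \<le> d \<Longrightarrow> y \<le> x \<Longrightarrow> x - y + 2 * d \<le> \<delta> \<Longrightarrow> R x - R y \<le> \<eta> / 2"
        using near_steady_equicontinuous[of "\<eta> / 2"] by (metis half_gt_zero)
      have "(\<lambda>n. \<bar>a n\<bar> + 2 * e n) \<longlonglongrightarrow> \<bar>0\<bar> + 2 * 0" by (intro tendsto_intros a e)
      then have "\<forall>\<^sub>F n in sequentially. \<bar>a n\<bar> + 2 * e n < \<delta>"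
        by (rule order_tendstoD) (use \<delta> in simp)
      then obtain M where M: "\<And>n. M \<le> n \<Longrightarrow> \<bar>a n\<bar> + 2 * e n < \<delta>" by (auto simp: eventually_sequentially)
      have "norm (R (s n) x - R (s n) (x + a n) - 0) < \<eta>" if "M \<le> n" for n
        using M[OF that] \<delta>(2)[OF e(3)[of n] e(1), of x "x + a n"] \<delta>(2)[OF e(3)[of n] e(1), of "x + a n" x]
          monoD[OF RD(2)[of "s n"], of x "x + a n"] monoD[OF RD(2)[of "s n"], of "x + a n" x] \<open>0 < \<eta>\<close>
        by (cases "0 \<le> a n") auto
      then show "\<exists>M. \<forall>n\<ge>M. norm (R (s n) x - R (s n) (x + a n) - 0) < \<eta>" by blast
    qed
  qed
  have avg_lim: "(\<lambda>n. wavg (\<lambda>y. v (R (s n) y)) (x + a n)) \<longlonglongrightarrow> wavg (\<lambda>y. v (F y)) x" if a: "a \<longlonglongrightarrow> 0" for x a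
    unfolding wavg_def
  proof (rule dominated_convergence(2)[where h = w])
    show "(\<lambda>t. v (R (s n) (x + a n + t)) * w t) integrable_on {0..h}" for n by (intro wavg_integrable RD(8))
    show "w integrable_on {0..h}" by (intro w_integrable) auto
    show "norm (v (R (s n) (x + a n + t)) * w t) \<le> w t" for n t
      using v_bounds[OF RD(3,5)] w_nonneg[of t] by (simp add: mult_left_le_one_le abs_mult)
    fix t
    have "(\<lambda>n. v (R (s n) (x + t + a n))) \<longlonglongrightarrow> v (F (x + t))"
      using F_bounds[of "x + t"] rp_less RD(3,5)
      by (intro continuous_on_tendsto_compose[OF v_cont lim_shift[OF a]]) auto
    then show "(\<lambda>n. v (R (s n) (x + a n + t)) * w t) \<longlonglongrightarrow> v (F (x + t)) * w t"
      by (intro tendsto_mult tendsto_const) (simp add: add_ac)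
  qed
  have "F x * wavg (\<lambda>y. v (F y)) x = rp * v rp" for x
  proof (rule antisym)
    have "(\<lambda>n. R (s n) x * wavg (\<lambda>y. v (R (s n) y)) (x + e n)) \<longlonglongrightarrow> F x * wavg (\<lambda>y. v (F y)) x"
      by (intro tendsto_mult lim avg_lim e)
    then show "F x * wavg (\<lambda>y. v (F y)) x \<le> rp * v rp"
      by (rule tendsto_upperbound) (use near_steadyD(6)[OF e(3)] in auto)
    have "(\<lambda>n. - e n) \<longlonglongrightarrow> 0" using tendsto_minus[OF e(2)] by simp
    then have "(\<lambda>n. R (s n) x * wavg (\<lambda>y. v (R (s n) y)) (x + - e n)) \<longlonglongrightarrow> F x * wavg (\<lambda>y. v (F y)) x"
      by (intro tendsto_mult lim avg_lim)
    then show "rp * v rp \<le> F x * wavg (\<lambda>y. v (F y)) x"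
      by (rule tendsto_lowerbound) (use near_steadyD(7)[OF e(3)] in auto)
  qed
  then have "steady F"
    using F F_cont F_bounds by (auto simp: steady_def continuous_on_eq_continuous_at)
  then show ?thesis using s lim by blast
qed

text \<open>A bounded monotone profile converges to its supremum \<open>b\<close>, and the equation
  at infinity gives \<open>b\<close> the same flux as \<open>rp\<close>.\<close>

lemma steady_limit:
  assumes R: "steady R"
    and flux_inj: "\<And>b. R x0 \<le> b \<Longrightarrow> b \<le> rp \<Longrightarrow> b * v b = rp * v rp \<Longrightarrow> b = rp"
  shows "(R \<longlongrightarrow> rp) at_top"
proof -
  note RD = steadyD[OF R]
  define b where "b = (SUP x. R x)"
  have bdd: "bdd_above (range R)" using RD(4) by (auto intro: bdd_aboveI[of _ rp])
  have up: "R x \<le> b" for x unfolding b_def by (intro cSUP_upper bdd) simp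
  have lim: "(R \<longlongrightarrow> b) at_top"
  proof (rule order_tendstoI)
    fix a assume "a < b"
    then obtain x where "a < R x" unfolding b_def using less_cSUP_iff[OF _ bdd] by auto
    then have "\<forall>y\<ge>x. a < R y" using monoD[OF RD(2)] by (meson less_le_trans)
    then show "\<forall>\<^sub>F y in at_top. a < R y" by (auto simp: eventually_at_top_linorder)
  next
    fix a assume "b < a"
    then show "\<forall>\<^sub>F y in at_top. R y < a" by (intro always_eventually allI le_less_trans[OF up])
  qed
  have "b \<le> rp" unfolding b_def using RD(4) by (intro cSUP_least) auto
  moreover have "b * v b = rp * v rp"
    using steady_constant[OF RD(1,2) _ _ lim] RD(3,5,6) by metis
  ultimately have "b = rp" using flux_inj up by blast
  then show ?thesis using lim by simp
qed

end

section \<open>The velocity function and the main theorem\<close>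

lemma velocity_has_derivative:
  assumes "velocity_function v" "x \<in> {0..1}"
  shows "(v has_real_derivative unit_deriv v x) (at x within {0..1})"
  using assms vector_derivative_works[of v "at x within {0..1}"]
  by (auto simp: velocity_function_def C2_unit_def differentiable_on_def unit_deriv_def
      has_real_derivative_iff_has_vector_derivative)

lemma unit_deriv_flux:
  assumes "velocity_function v" "x \<in> {0..1}"
  shows "(flux v has_real_derivative unit_deriv (flux v) x) (at x within {0..1})"
    "unit_deriv (flux v) x = v x + x * unit_deriv v x"
proof -
  have *: "(flux v has_real_derivative v x + x * unit_deriv v x) (at x within {0..1})"
    unfolding flux_def[abs_def]
    by (auto intro!: derivative_eq_intros velocity_has_derivative[OF assms])
  show "unit_deriv (flux v) x = v x + x * unit_deriv v x"
    unfolding unit_deriv_def[of "flux v"]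
    using * assms(2) by (intro vector_derivative_within_closed_interval)
      (auto simp: has_real_derivative_iff_has_vector_derivative)
  with * show "(flux v has_real_derivative unit_deriv (flux v) x) (at x within {0..1})" by simp
qed

lemma MVT_unit_interval:
  assumes "0 \<le> a" "a < b" "b \<le> 1"
    and "\<And>x. x \<in> {0..1} \<Longrightarrow> (g has_real_derivative g' x) (at x within {0..1})"
  shows "\<exists>\<xi>\<in>{a<..<b}. g b - g a = g' \<xi> * (b - a)"
proof (rule mvt_simple[OF assms(2), of g "\<lambda>x. (*) (g' x)"])
  fix x assume "a \<le> x" "x \<le> b"
  then have "x \<in> {0..1}" "{a..b} \<subseteq> {0..1}" using assms(1,3) by auto
  then show "(g has_derivative (*) (g' x)) (at x within {a..b})"
    using DERIV_subset[OF assms(4)] by (simp add: has_field_derivative_def)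
qed

text \<open>The constants are the extreme values of the continuous derivative on
  \<open>[0, 1]\<close>, with signs reversed.\<close>

lemma velocity_lipschitz:
  assumes "velocity_function v"
  obtains \<beta> Lv where "0 < \<beta>"
    "\<And>a b. 0 \<le> a \<Longrightarrow> a \<le> b \<Longrightarrow> b \<le> 1 \<Longrightarrow> \<beta> * (b - a) \<le> v a - v b"
    "\<And>a b. 0 \<le> a \<Longrightarrow> a \<le> b \<Longrightarrow> b \<le> 1 \<Longrightarrow> v a - v b \<le> Lv * (b - a)"
proof -
  have cont: "continuous_on {0..1} (unit_deriv v)"
    using assms by (auto simp: velocity_function_def C2_unit_def intro: differentiable_imp_continuous_on)
  obtain xm where xm: "xm \<in> {0..1}" "\<And>x. x \<in> {0..1} \<Longrightarrow> unit_deriv v x \<le> unit_deriv v xm"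
    using continuous_attains_sup[OF _ _ cont] by auto
  obtain xl where xl: "xl \<in> {0..1}" "\<And>x. x \<in> {0..1} \<Longrightarrow> unit_deriv v xl \<le> unit_deriv v x"
    using continuous_attains_inf[OF _ _ cont] by auto
  have bounds: "- unit_deriv v xm * (b - a) \<le> v a - v b \<and> v a - v b \<le> - unit_deriv v xl * (b - a)"
    if ab: "0 \<le> a" "a \<le> b" "b \<le> 1" for a b
  proof (cases "a = b")
    case False
    then obtain \<xi> where \<xi>: "a < \<xi>" "\<xi> < b" "v b - v a = unit_deriv v \<xi> * (b - a)"
      using MVT_unit_interval[OF ab(1) _ ab(3) velocity_has_derivative[OF assms]] ab(2) by auto
    have "unit_deriv v xl * (b - a) \<le> unit_deriv v \<xi> * (b - a)"
      "unit_deriv v \<xi> * (b - a) \<le> unit_deriv v xm * (b - a)"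
      using xm(2)[of \<xi>] xl(2)[of \<xi>] \<xi> ab by (auto intro!: mult_right_mono)
    then show ?thesis using \<xi>(3) by simp
  qed simp
  show ?thesis
    by (rule that[of "- unit_deriv v xm" "- unit_deriv v xl"])
      (use bounds xm(1) assms in \<open>auto simp: velocity_function_def\<close>)
qed

lemma flux_decreasing:
  assumes "velocity_function v" "stagnation_point v r" "r \<le> a" "a < b" "b \<le> 1"
  shows "flux v b < flux v a"
proof -
  have "0 \<le> a" using assms(2,3) by (auto simp: stagnation_point_def)
  then obtain \<xi> where \<xi>: "a < \<xi>" "\<xi> < b" "flux v b - flux v a = unit_deriv (flux v) \<xi> * (b - a)"
    using MVT_unit_interval[OF _ assms(4,5) unit_deriv_flux(1)[OF assms(1)]] by auto
  have "unit_deriv (flux v) \<xi> < 0" using assms \<xi> by (auto simp: stagnation_point_def)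
  then have "unit_deriv (flux v) \<xi> * (b - a) < 0" using assms(4) by (simp add: mult_neg_pos)
  then show ?thesis using \<xi>(3) by linarith
qed

text \<open>Negative flux slope at \<open>r\<close> says that \<open>- r * v' / v\<close> exceeds 1
  there. Any \<kappa> strictly in between leaves a strict inequality, which survives when the
  derivative is replaced by difference quotients near \<open>r\<close>.\<close>

lemma velocity_slope:
  assumes v: "velocity_function v" and r: "0 < r" "r < 1" "0 < v r" and neg: "unit_deriv (flux v) r < 0"
  obtains \<kappa> q0 where "1 < \<kappa>" "q0 < r"
    "\<And>q. q0 \<le> q \<Longrightarrow> q \<le> r \<Longrightarrow> \<kappa> * (r - q) * v q \<le> r * (v q - v r)"
proof -
  let ?D = "unit_deriv v r"
  have "v r + r * ?D < 0" using neg unit_deriv_flux(2)[OF v, of r] r by simp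
  then have k: "1 < - r * ?D / v r" using r by (simp add: field_simps)
  then obtain \<kappa> where \<kappa>: "1 < \<kappa>" "\<kappa> < - r * ?D / v r" using dense by blast
  then have neg': "r * ?D + \<kappa> * v r < 0" using r by (simp add: field_simps)
  have D: "(v has_real_derivative ?D) (at r within {0..1})" using r by (intro velocity_has_derivative v) auto
  have "((\<lambda>q. (v q - v r) / (q - r)) \<longlongrightarrow> ?D) (at r within {0..1})"
    using D by (simp add: has_field_derivative_iff)
  moreover have "(v \<longlongrightarrow> v r) (at r within {0..1})"
    using DERIV_continuous[OF D] by (simp add: continuous_within)
  ultimately have "((\<lambda>q. r * ((v q - v r) / (q - r)) + \<kappa> * v q) \<longlongrightarrow> r * ?D + \<kappa> * v r) (at r within {0..1})"
    by (intro tendsto_intros)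
  then have "\<forall>\<^sub>F q in at r within {0..1}. r * ((v q - v r) / (q - r)) + \<kappa> * v q < 0"
    using neg' by (rule order_tendstoD)
  then obtain d where d: "0 < d" "\<And>q. q \<in> {0..1} \<Longrightarrow> q \<noteq> r \<Longrightarrow> dist q r < d \<Longrightarrow>
      r * ((v q - v r) / (q - r)) + \<kappa> * v q < 0"
    by (auto simp: eventually_at)
  show ?thesis
  proof (rule that[OF \<kappa>(1)])
    show "max 0 (r - d / 2) < r" using d(1) r by simp
    fix q assume q: "max 0 (r - d / 2) \<le> q" "q \<le> r"
    show "\<kappa> * (r - q) * v q \<le> r * (v q - v r)"
    proof (cases "q = r")
      case False
      then have "r * ((v q - v r) / (q - r)) + \<kappa> * v q < 0"
        using q d(1) r by (intro d(2)) (auto simp: dist_real_def)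
      then have "(r * ((v q - v r) / (q - r)) + \<kappa> * v q) * (r - q) \<le> 0"
        using q by (intro mult_nonpos_nonneg) auto
      moreover have "(v q - v r) / (q - r) * (r - q) = - (v q - v r)" using False by (simp add: field_simps)
      then have "r * ((v q - v r) / (q - r)) * (r - q) = - r * (v q - v r)"
        by (simp only: mult.assoc minus_mult_commute)
      ultimately show ?thesis by (simp add: distrib_right algebra_simps)
    qed simp
  qed
qed

lemma mono_tendsto_bounds:
  fixes f :: "real \<Rightarrow> real"
  assumes "mono f"
  shows "(f \<longlongrightarrow> a) at_bot \<Longrightarrow> a \<le> f x" "(f \<longlongrightarrow> b) at_top \<Longrightarrow> f x \<le> b"
proof -
  show "a \<le> f x" if "(f \<longlongrightarrow> a) at_bot"
    by (rule tendsto_upperbound[OF that])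
      (auto simp: eventually_at_bot_linorder intro!: exI[of _ x] monoD[OF assms])
  show "f x \<le> b" if "(f \<longlongrightarrow> b) at_top"
    by (rule tendsto_lowerbound[OF that])
      (auto simp: eventually_at_top_linorder intro!: exI[of _ x] monoD[OF assms])
qed

theorem mainTheorem15:
  fixes h :: real and w v :: "real \<Rightarrow> real"
    and \<rho>hat \<rho>minus \<rho>plus :: real
    and P :: "real \<Rightarrow> real \<Rightarrow> real" and Q :: "real \<Rightarrow> real"
  assumes "h > 0"
    and "weight_function h w"
    and "velocity_function v"
    and "stagnation_point v \<rho>hat"
    and "0 < \<rho>minus" and "\<rho>minus < \<rho>hat" and "\<rho>hat < \<rho>plus" and "\<rho>plus < 1"
    and "flux v \<rho>minus = flux v \<rho>plus"
    and "\<And>l. l > 0 \<Longrightarrow> discrete_stationary_profile w v l (P l)"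
    and "\<And>l. l > 0 \<Longrightarrow> (P l \<longlongrightarrow> \<rho>minus) at_bot"
    and "\<And>l. l > 0 \<Longrightarrow> (P l \<longlongrightarrow> \<rho>plus) at_top"
    and "\<And>l. l > 0 \<Longrightarrow> P l 0 = \<rho>hat"
    and "stationary_profile h w v Q"
    and "(Q \<longlongrightarrow> \<rho>minus) at_bot"
    and "(Q \<longlongrightarrow> \<rho>plus) at_top"
    and "Q 0 = \<rho>hat"
  shows "\<forall>x. ((\<lambda>l. P l x) \<longlongrightarrow> Q x) (at_right 0)"
proof -
  note v = \<open>velocity_function v\<close>
  obtain \<beta> Lv where lip: "0 < \<beta>"
    "\<And>a b. 0 \<le> a \<Longrightarrow> a \<le> b \<Longrightarrow> b \<le> 1 \<Longrightarrow> \<beta> * (b - a) \<le> v a - v b"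
    "\<And>a b. 0 \<le> a \<Longrightarrow> a \<le> b \<Longrightarrow> b \<le> 1 \<Longrightarrow> v a - v b \<le> Lv * (b - a)"
    using velocity_lipschitz[OF v] by blast
  have \<rho>: "0 < \<rho>plus" "\<rho>plus < 1" using assms by auto
  interpret T: nonlocal_traffic h w v \<rho>plus Lv \<beta>
    by unfold_locales (use assms(1,2) v lip \<rho> in \<open>auto simp: weight_function_def velocity_function_def\<close>)
  have "unit_deriv (flux v) \<rho>plus < 0" using assms(4,7,8) by (auto simp: stagnation_point_def)
  then obtain \<kappa> q0 where slope: "1 < \<kappa>" "q0 < \<rho>plus"
    "\<And>q. q0 \<le> q \<Longrightarrow> q \<le> \<rho>plus \<Longrightarrow> \<kappa> * (\<rho>plus - q) * v q \<le> \<rho>plus * (v q - v \<rho>plus)"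
    using velocity_slope[OF v \<rho> T.v_rp_pos] by blast
  interpret S: nonlocal_traffic_congested h w v \<rho>plus Lv \<beta> \<kappa> q0
    by unfold_locales (use slope in auto)

  \<comment> \<open>To the right of the stagnation point the flux is strictly decreasing.\<close>
  have flux_inj: "b = \<rho>plus" if "\<rho>hat \<le> b" "b \<le> \<rho>plus" "b * v b = \<rho>plus * v \<rho>plus" for b
    using flux_decreasing[OF v assms(4) that(1), of \<rho>plus] that \<rho> by (force simp: flux_def)

  have near: "T.near_steady (l / \<rho>minus) (P l)" if l: "0 < l" for l
  proof -
    have prof: "continuous_on UNIV (P l)" "mono (P l)"
      using assms(10)[OF l] by (auto simp: discrete_stationary_profile_def)
    note bounds = mono_tendsto_bounds[OF prof(2)]
    interpret D: discrete_profile h w v \<rho>plus Lv \<beta> "P l" l \<rho>minus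
      by unfold_locales
        (use assms(10)[OF l] l assms(5) assms(12)[OF l] bounds(1)[OF assms(11)[OF l]] bounds(2)[OF assms(12)[OF l]]
          in \<open>auto simp: discrete_stationary_profile_def\<close>)
    show ?thesis
      unfolding T.near_steady_def using D.P_cont D.P_mono D.P_unit(1) D.P_le D.profile_squeeze by blast
  qed

  have Q: "continuous_on UNIV Q" "mono Q" "\<And>x. 0 \<le> Q x" "\<And>x. Q x \<le> 1"
    using assms(14) by (auto simp: stationary_profile_def less_imp_le)
  obtain c where c: "\<And>x. Q x * T.wavg (\<lambda>y. v (Q y)) x = c"
    using assms(14) by (auto simp: stationary_profile_def T.wavg_def)
  have "c = \<rho>plus * v \<rho>plus" by (rule T.steady_constant[OF Q assms(16) c])
  then have Q_steady: "T.steady Q"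
    unfolding T.steady_def using Q c mono_tendsto_bounds(2)[OF Q(2) assms(16)] by auto

  show ?thesis
  proof (rule allI, rule ccontr)
    fix x assume "\<not> ((\<lambda>l. P l x) \<longlongrightarrow> Q x) (at_right 0)"
    then obtain e where e: "0 < e" "\<not> (\<forall>\<^sub>F l in at_right 0. dist (P l x) (Q x) < e)"
      by (auto simp: tendsto_iff)
    \<comment> \<open>Failure of convergence gives bad car lengths arbitrarily close to 0.\<close>
    have "\<exists>l. 0 < l \<and> l < inverse (real (Suc n)) \<and> e \<le> dist (P l x) (Q x)" for n
    proof (rule ccontr)
      assume "\<not> ?thesis"
      then have "\<forall>l>0. l < inverse (real (Suc n)) \<longrightarrow> dist (P l x) (Q x) < e" by (simp add: not_le)
      moreover have "0 < inverse (real (Suc n))" by simp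
      ultimately have "\<forall>\<^sub>F l in at_right 0. dist (P l x) (Q x) < e"
        unfolding eventually_at_right[OF zero_less_one] by blast
      then show False using e(2) by simp
    qed
    then obtain l where l: "\<And>n. 0 < l n" "\<And>n. l n < inverse (real (Suc n))" "\<And>n. e \<le> dist (P (l n) x) (Q x)"
      by metis
    have "l \<longlonglongrightarrow> 0"
      by (rule tendsto_sandwich[OF _ _ tendsto_const LIMSEQ_inverse_real_of_nat]) (use l in \<open>auto simp: less_imp_le\<close>)
    then have "(\<lambda>n. l n / \<rho>minus) \<longlonglongrightarrow> 0" using tendsto_divide_zero by blast
    then obtain s F where F: "strict_mono (s :: nat \<Rightarrow> nat)" "T.steady F" "\<And>y. (\<lambda>n. P (l (s n)) y) \<longlonglongrightarrow> F y"
      using T.near_steady_compact[of "\<lambda>n. l n / \<rho>minus" "\<lambda>n. P (l n)"] near l(1) assms(5)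
      by (auto simp: less_imp_le)
    \<comment> \<open>The normalisation survives the limit. It keeps \<open>F\<close> from being the
      constant \<rho>plus, puts its limit at infinity where the flux is injective, and fixes the
      shift.\<close>
    have F0: "F 0 = \<rho>hat" using LIMSEQ_unique[OF F(3)[of 0]] assms(13) l(1) by simp
    have "(F \<longlongrightarrow> \<rho>plus) at_top"
      using F0 by (intro T.steady_limit[OF F(2), of 0] flux_inj) auto
    then have "F = Q"
      using F0 assms(7,17) by (intro S.steady_unique[OF F(2) _ Q_steady assms(16)]) auto
    then have "(\<lambda>n. dist (P (l (s n)) x) (Q x)) \<longlonglongrightarrow> 0"
      using F(3)[of x] by (simp add: tendsto_dist_iff[symmetric])
    then have "e \<le> 0" by (rule tendsto_lowerbound) (use l(3) in auto)
    then show False using e(1) by simp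
  qed
qed

end
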